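(* Assume that: (i) the monic banded Hessenberg matrix $T$ is bounded, i.e. $\|T\|_\infty=\sup_i\sum_j|T_{i,j}|<\infty$, and admits a positive bidiagonal factorization $T=L_1L_2\cdots L_pU$; (ii) the type I recursion polynomials $\{A^{(1)}_n,\dots,A^{(p)}_n\}_{n=0}^\infty$ are determined by an initial condition matrix $\nu$ such that $\nu^{-\top}=\mathscr L\mathscr C$ for some entrywise nonnegative upper unitriangular matrix $\mathscr C\in\mathbb R^{p\times p}$. Then there exist $p$ nondecreasing functions $\psi_1,\dots,\psi_p$ and corresponding positive Lebesgue--Stieltjes measures $\mathrm d\psi_1,\dots,\mathrm d\psi_p$ with compact support contained in $\Delta$, such that the following biorthogonality holds: $$\int_\Delta\Big(A^{(1)}_k(x)\,\mathrm d\psi_1(x)+\cdots+A^{(p)}_k(x)\,\mathrm d\psi_p(x)\Big)B_l(x)=\delta_{k,l},\qquad k,l\in\mathbb N_0 .$$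
   Context: Fix an integer $p\ge 1$; $\mathbb N_0=\{0,1,2,\dots\}$. $T=(T_{i,j})_{i,j\ge 0}$ is a real semi-infinite monic banded lower Hessenberg matrix: $T_{n,n+1}=1$ for all $n\ge0$, $T_{i,j}=0$ if $j>i+1$ or $j<i-p$, and $T_{n,n-p}\neq0$ for $n\ge p$. $T^{[N]}=(T_{i,j})_{0\le i,j\le N}$. Type II recursion polynomials: $B_0=1$ and $B_{n+1}=(x-T_{n,n})B_n-T_{n,n-1}B_{n-1}-\cdots-T_{n,n-p}B_{n-p}$ for $n\in\mathbb N_0$ (terms with negative index are $0$). Type I recursion polynomials: given a real lower unitriangular $p\times p$ matrix $\nu$ (the initial condition matrix), for $a\in\{1,\dots,p\}$ put $A^{(a)}_{j}=\nu_{j+1,a}$ for $0\le j\le p-1$, $A^{(a)}_{-1}=0$, and define the remaining ones by $A^{(a)}_{n-1}+T_{n,n}A^{(a)}_n+\cdots+T_{n+p,n}A^{(a)}_{n+p}=xA^{(a)}_n$, $n\in\mathbb N_0$. Here $\nu^{-\top}=(\nu^{-1})^\top$. Positive bidiagonal factorization: $T=L_1\cdots L_pU$ with semi-infinite bidiagonal matrices, where $L_k$ is lower bidiagonal with all diagonal entries $1$ and $(L_k)_{j+1,j}=\alpha_{k+1+j(p+1)}$, $U$ is upper bidiagonal with all superdiagonal entries $1$ and $U_{j,j}=\alpha_{1+j(p+1)}$ ($j\in\mathbb N_0$), and $\alpha_i>0$ for all $i\ge1$. The matrix $\mathscr L=[\mathscr L_1\ \cdots\ \mathscr L_p]\in\mathbb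 R^{p\times p}$ has columns $\mathscr L_1=(1,0,\dots,0)^\top$ and, for $k\in\{2,\dots,p\}$, $\mathscr L_k=\frac1{d_k}L_1^{[p-1]}\cdots L_{k-1}^{[p-1]}(1,0,\dots,0)^\top$, $d_k=\alpha_k\alpha_{k+p}\alpha_{k+2p}\cdots\alpha_{k+(k-2)p}$, where $L_i^{[p-1]}$ is the leading $p\times p$ principal submatrix of $L_i$. Under a positive bidiagonal factorization the eigenvalues $\lambda^{[N]}_1>\cdots>\lambda^{[N]}_{N+1}>0$ of $T^{[N]}$ are simple and positive; $\lambda_1^{[N]}$ is increasing and $\lambda_{N+1}^{[N]}$ decreasing in $N$. $\Delta=[\xi,\eta]$ with $\xi=\lim_{N\to\infty}\lambda^{[N]}_{N+1}$ and $\eta=\lim_{N\to\infty}\lambda_1^{[N]}$. *)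

theory Defs
  imports "HOL-Analysis.Analysis" "Jordan_Normal_Form.Spectral_Radius"
    "Jordan_Normal_Form.Gauss_Jordan_Elimination"
begin

section \<open>Semi-infinite matrices\<close>

type_synonym smat = "nat \<Rightarrow> nat \<Rightarrow> real"

text \<open>The product of semi-infinite matrices is only used with a row-finite left factor, for which
  the index set of the sum is finite.\<close>

definition smat_mult :: "smat \<Rightarrow> smat \<Rightarrow> smat" where
  "smat_mult A M = (\<lambda>i j. \<Sum>k\<in>{k. A i k \<noteq> 0}. A i k * M k j)"

text \<open>\<open>trunc N M\<close> is \<open>M\<^sup>[\<^sup>N\<^sup>]\<close>, a matrix of size \<open>N + 1\<close>.\<close>

definition trunc :: "nat \<Rightarrow> smat \<Rightarrow> real mat" where
  "trunc N M = Matrix.mat (Suc N) (Suc N) (\<lambda>(i, j). M i j)"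

definition smat_norm_inf :: "smat \<Rightarrow> ennreal" where
  "smat_norm_inf M = (SUP i. \<Sum>j. ennreal \<bar>M i j\<bar>)"

definition monic_banded_Hessenberg :: "nat \<Rightarrow> smat \<Rightarrow> bool" where
  "monic_banded_Hessenberg p T \<longleftrightarrow>
     (\<forall>n. T n (Suc n) = 1) \<and>
     (\<forall>i j. j > i + 1 \<or> j + p < i \<longrightarrow> T i j = 0) \<and>
     (\<forall>n\<ge>p. T n (n - p) \<noteq> 0)"


section \<open>Positive bidiagonal factorization\<close>

text \<open>The parameters \<open>\<alpha>\<close> are indexed from 1, and \<open>\<alpha> 0\<close> is never used. The factors
  \<open>lower_factor p \<alpha> k\<close> are the \<open>L\<^sub>k\<close>, for \<open>1 \<le> k \<le> p\<close>.\<close>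

definition lower_factor :: "nat \<Rightarrow> (nat \<Rightarrow> real) \<Rightarrow> nat \<Rightarrow> smat" where
  "lower_factor p \<alpha> k = (\<lambda>i j. if i = j then 1
     else if i = j + 1 then \<alpha> (k + 1 + j * (p + 1)) else 0)"

definition upper_factor :: "nat \<Rightarrow> (nat \<Rightarrow> real) \<Rightarrow> smat" where
  "upper_factor p \<alpha> = (\<lambda>i j. if i = j then \<alpha> (1 + j * (p + 1))
     else if j = i + 1 then 1 else 0)"

definition positive_bidiagonal_factorization :: "nat \<Rightarrow> smat \<Rightarrow> (nat \<Rightarrow> real) \<Rightarrow> bool" where
  "positive_bidiagonal_factorization p T \<alpha> \<longleftrightarrow>
     (\<forall>i\<ge>1. \<alpha> i > 0) \<and>
     T = foldr (\<lambda>k M. smat_mult (lower_factor p \<alpha> k) M) [1..<Suc p] (upper_factor p \<alpha>)"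

text \<open>The columns \<open>\<L>\<^sub>k\<close>, for \<open>1 \<le> k \<le> p\<close>. For \<open>k = 1\<close> both products are empty and the
  column is the first unit vector.\<close>

definition script_L_col :: "nat \<Rightarrow> (nat \<Rightarrow> real) \<Rightarrow> nat \<Rightarrow> real Matrix.vec" where
  "script_L_col p \<alpha> k =
     (1 / (\<Prod>i<k - 1. \<alpha> (k + i * p))) \<cdot>\<^sub>v
       foldr (\<lambda>i v. trunc (p - 1) (lower_factor p \<alpha> i) *\<^sub>v v) [1..<k] (unit_vec p 0)"

definition script_L :: "nat \<Rightarrow> (nat \<Rightarrow> real) \<Rightarrow> real mat" where
  "script_L p \<alpha> = mat_of_cols p (map (script_L_col p \<alpha>) [1..<Suc p])"


section \<open>Unitriangular matrices\<close>

definition lower_unitriangular :: "nat \<Rightarrow> real mat \<Rightarrow> bool" where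
  "lower_unitriangular n M \<longleftrightarrow> M \<in> carrier_mat n n \<and>
     (\<forall>i<n. M $$ (i, i) = 1) \<and> (\<forall>i<n. \<forall>j<n. i < j \<longrightarrow> M $$ (i, j) = 0)"

definition upper_unitriangular :: "nat \<Rightarrow> real mat \<Rightarrow> bool" where
  "upper_unitriangular n M \<longleftrightarrow> M \<in> carrier_mat n n \<and>
     (\<forall>i<n. M $$ (i, i) = 1) \<and> (\<forall>i<n. \<forall>j<n. j < i \<longrightarrow> M $$ (i, j) = 0)"

definition nonneg_entries :: "nat \<Rightarrow> real mat \<Rightarrow> bool" where
  "nonneg_entries n M \<longleftrightarrow> (\<forall>i<n. \<forall>j<n. M $$ (i, j) \<ge> 0)"

text \<open>The option returned by \<open>mat_inverse\<close> is \<open>None\<close> only for singular matrices.\<close>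

definition inverse_transpose :: "real mat \<Rightarrow> real mat" where
  "inverse_transpose M = transpose_mat (the (mat_inverse M))"


section \<open>Recursion polynomials\<close>

fun type_II_poly :: "nat \<Rightarrow> smat \<Rightarrow> nat \<Rightarrow> real poly" where
  "type_II_poly p T 0 = 1"
| "type_II_poly p T (Suc n) = [:- T n n, 1:] * type_II_poly p T n
     - (\<Sum>k\<in>{1..min p n}. Polynomial.smult (T n (n - k)) (type_II_poly p T (n - k)))"

text \<open>\<open>A a n\<close> stands for \<open>A\<^sup>(\<^sup>a\<^sup>)\<^sub>n\<close> with \<open>1 \<le> a \<le> p\<close>, while the entries of \<open>\<nu>\<close> are indexed from 0.
  Since \<open>T (n + p) n \<noteq> 0\<close>, the recurrence determines \<open>A a (n + p)\<close> from the preceding polynomials,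
  so for given \<open>T\<close> and \<open>\<nu>\<close> there is exactly one such family.\<close>

definition type_I_polys :: "nat \<Rightarrow> smat \<Rightarrow> real mat \<Rightarrow> (nat \<Rightarrow> nat \<Rightarrow> real poly) \<Rightarrow> bool" where
  "type_I_polys p T \<nu> A \<longleftrightarrow> (\<forall>a\<in>{1..p}.
     (\<forall>j<p. A a j = [:\<nu> $$ (j, a - 1):]) \<and>
     (\<forall>n. (if n = 0 then 0 else A a (n - 1))
          + (\<Sum>i\<le>p. Polynomial.smult (T (n + i) n) (A a (n + i))) = [:0, 1:] * A a n))"


section \<open>The interval containing the spectra\<close>

definition largest_eigenvalue :: "smat \<Rightarrow> nat \<Rightarrow> real" where
  "largest_eigenvalue T N = Max {x. eigenvalue (trunc N T) x}"

definition smallest_eigenvalue :: "smat \<Rightarrow> nat \<Rightarrow> real" where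
  "smallest_eigenvalue T N = Min {x. eigenvalue (trunc N T) x}"

definition Delta :: "smat \<Rightarrow> real set" where
  "Delta T = {lim (smallest_eigenvalue T)..lim (largest_eigenvalue T)}"


section \<open>Lebesgue--Stieltjes measures\<close>

text \<open>\<open>interval_measure \<psi>\<close> is the Lebesgue--Stieltjes measure of a nondecreasing \<open>\<psi>\<close> only if \<open>\<psi>\<close> is
  right-continuous, hence that normalization.\<close>

definition stieltjes_function :: "(real \<Rightarrow> real) \<Rightarrow> bool" where
  "stieltjes_function \<psi> \<longleftrightarrow> mono \<psi> \<and> (\<forall>x. continuous (at_right x) \<psi>)"

definition measure_support :: "real measure \<Rightarrow> real set" where
  "measure_support M = {x. \<forall>U. open U \<and> x \<in> U \<longrightarrow> emeasure M U > 0}"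

end

theory Submission
  imports Defs "HOL-Probability.Helly_Selection"
begin

text \<open>The measures are weak limits of Gauss-type quadratures supported on the spectra of the
truncations of \<open>T\<close>, and the only analytic input is one property of the recurrence
\<open>f\<^sub>n\<^sub>+\<^sub>1 = x f\<^sub>n - \<beta>\<^sub>n f\<^sub>n\<^sub>-\<^sub>p\<close> with \<open>\<beta>\<^sub>n > 0\<close>, in which the factor \<open>x\<close> is present exactly when
\<open>p + 1\<close> divides \<open>n + 1\<close>.

This recurrence is what a positive bidiagonal factorization means for the eigenvectors. Writing the
equation for a right eigenvector factor by factor, the type II polynomials \<open>B\<^sub>j\<close> become the members
\<open>f\<close> with index \<open>j (p + 1)\<close> of a forward sequence (\<open>type_II_poly_eq_forward\<close>). Writing it for a left
eigenvector of the truncation of size \<open>N + 1\<close>, its entries become members of a backward sequence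
\<open>H\<^sub>m\<close>, which obeys the same recurrence with the coefficients read from the end.

For \<open>z\<close> in the upper half plane, the normalized values \<open>f\<^sub>n(z) / z ^ deg f\<^sub>n\<close> of \<open>p + 1\<close> consecutive
polynomials turn counterclockwise, all within a sector of angle \<open>\<pi> - arg z\<close>
(\<open>sector_invariant\<close>); the recurrence preserves this. In particular no \<open>f\<^sub>n\<close> vanishes there, so that all
zeros are real. If moreover \<open>p + 1\<close> divides \<open>n\<close>, then \<open>Im (f\<^sub>n / f\<^sub>i) \<ge> Im z\<close> for the \<open>p + 1\<close> preceding
indices \<open>i\<close>, and letting \<open>z\<close> tend to a zero of \<open>F = f\<^sub>n\<close> one obtains \<open>F' G \<ge> G\<^sup>2\<close> there, for
\<open>G = f\<^sub>i\<close> (\<open>sparse_poly_residue\<close>). This inequality has three consequences: the zeros of \<open>B\<^sub>N\<^sub>+\<^sub>1\<close> are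
simple; those of \<open>B\<^sub>N\<close> lie in their convex hull, so that the extreme eigenvalues are monotone in \<open>N\<close> and
all spectra lie in \<open>Delta T\<close>; and the numbers \<open>H\<^sub>k(\<lambda>) / B\<^sub>N\<^sub>+\<^sub>1'(\<lambda>)\<close> with \<open>1 \<le> k \<le> p\<close>, where \<open>\<lambda>\<close> is
an eigenvalue, are nonnegative.

With these numbers as weights, a Christoffel--Darboux formula (left and right eigenvectors are dual)
shows that the \<open>k\<close>-th quadrature takes the values \<open>(L\<^sub>1 \<cdots> L\<^sub>k\<^sub>-\<^sub>1 e\<^sub>0)\<^sub>l\<close> on the polynomials
\<open>B\<^sub>l\<close>, as soon as \<open>N\<close> is large (\<open>quadrature_of_backward\<close>). These vectors are positive multiples of
the columns of \<open>\<L>\<close>, so the nonnegative combinations with coefficients from \<open>C\<close> produce the entries of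
\<open>\<L> C\<close>, the inverse transpose of \<open>\<nu>\<close>. By Helly's theorem they converge along a subsequence to
measures \<open>d\<psi>\<^sub>a\<close> on \<open>Delta T\<close> with \<open>\<integral> B\<^sub>l d\<psi>\<^sub>a = (\<nu>\<^sup>-\<^sup>1)\<^sub>a\<^sub>l\<close> (zero for \<open>l \<ge> p\<close>).
This is the biorthogonality for \<open>k < p\<close>, and the recurrences for \<open>A\<close> and \<open>B\<close> propagate it to all
\<open>k\<close> (\<open>biorthogonality\<close>).\<close>

section \<open>A sparse recurrence and its values in the upper half plane\<close>

text \<open>The common form of the forward and the backward recurrence. After division by the leading power of
\<open>x\<close> it reads \<open>g\<^sub>n\<^sub>+\<^sub>1 = g\<^sub>n - (\<beta>\<^sub>n / x) g\<^sub>n\<^sub>-\<^sub>p\<close>, in which the position of \<open>n\<close> modulo \<open>p + 1\<close> no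
longer occurs.\<close>
fun sparse_poly :: "nat \<Rightarrow> (nat \<Rightarrow> real) \<Rightarrow> nat \<Rightarrow> real poly" where
  "sparse_poly p \<beta> 0 = 1"
| "sparse_poly p \<beta> (Suc n) =
     (if Suc p dvd Suc n then [:0, 1:] * sparse_poly p \<beta> n else sparse_poly p \<beta> n)
     - (if p \<le> n then Polynomial.smult (\<beta> n) (sparse_poly p \<beta> (n - p)) else 0)"

lemma Im_inverse_nonpos: "Im w \<ge> 0 \<Longrightarrow> Im (inverse w) \<le> 0"
  by (simp add: divide_nonpos_nonneg)

text \<open>The two inequalities say that \<open>g\<^sub>n / g\<^sub>i\<close> has its argument between \<open>0\<close> and \<open>\<pi> - arg z\<close>. Dividing the
recurrence by \<open>g\<^sub>i\<close>, the new term \<open>- (\<beta> / z) g\<^sub>n\<^sub>-\<^sub>p / g\<^sub>i\<close> is the negative of the inverse of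
\<open>z g\<^sub>i / g\<^sub>n\<^sub>-\<^sub>p\<close>, which lies in the upper half plane by the second inequality for the pair
\<open>(n - p, i)\<close>; after multiplication by \<open>z\<close> the first inequality for that pair does the same. Each of the
two inequalities is therefore preserved by means of the other one.\<close>
lemma sector_invariant:
  fixes z :: complex and g :: "nat \<Rightarrow> complex" and \<beta> :: "nat \<Rightarrow> real"
  assumes p: "p \<ge> 1" and z: "Im z > 0" and \<beta>: "\<And>n. \<beta> n \<ge> 0" and g0: "g 0 \<noteq> 0"
    and g: "\<And>n. g (Suc n) = g n - (if p \<le> n then \<beta> n / z * g (n - p) else 0)"
  shows "g n \<noteq> 0 \<and> (\<forall>i\<le>n. n \<le> i + p \<longrightarrow> Im (g n / g i) \<ge> 0 \<and> Im (z * g n / g i) \<ge> Im z)"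
proof (induction n rule: less_induct)
  case (less n)
  have z0: "z \<noteq> 0"
    using z by auto
  show ?case
  proof (cases n)
    case 0
    then show ?thesis using g0 z by simp
  next
    case (Suc m)
    have nz: "g i \<noteq> 0" if "i \<le> m" for i
      using less.IH[of i] that Suc by simp
    have IH: "Im (g j / g i) \<ge> 0" "Im (z * g j / g i) \<ge> Im z"
      if "i \<le> j" "j \<le> m" "j \<le> i + p" for i j
      using less.IH[of j] that Suc by auto
    have *: "Im (g n / g i) \<ge> 0 \<and> Im (z * g n / g i) \<ge> Im z" if i: "i \<le> m" "n \<le> i + p" for i
    proof (cases "p \<le> m")
      case False
      then show ?thesis using g[of m] IH[of i m] i Suc by auto
    next
      case True
      let ?k = "m - p"
      have k: "?k \<le> i" "i \<le> ?k + p"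
        using True i Suc by auto
      have gn: "g n = g m - \<beta> m / z * g ?k"
        using g[of m] True Suc by simp
      have "Im (inverse (z * g i / g ?k)) \<le> 0"
        using IH(2)[OF k(1) i(1) k(2)] z by (intro Im_inverse_nonpos) linarith
      then have a: "\<beta> m * Im (inverse (z * g i / g ?k)) \<le> 0"
        using \<beta> by (simp add: mult_nonneg_nonpos)
      have "Im (inverse (g i / g ?k)) \<le> 0"
        using IH(1)[OF k(1) i(1) k(2)] by (intro Im_inverse_nonpos)
      then have b: "\<beta> m * Im (inverse (g i / g ?k)) \<le> 0"
        using \<beta> by (simp add: mult_nonneg_nonpos)
      have "g n / g i = g m / g i - of_real (\<beta> m) * inverse (z * g i / g ?k)"
        using nz[of i] nz[of ?k] i z0 k by (simp add: gn field_simps)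
      then have "Im (g n / g i) = Im (g m / g i) - \<beta> m * Im (inverse (z * g i / g ?k))"
        by (simp only: minus_complex.simps Im_complex_of_real Re_complex_of_real times_complex.simps)
      moreover have "z * g n / g i = z * g m / g i - of_real (\<beta> m) * inverse (g i / g ?k)"
        using nz[of i] nz[of ?k] i z0 k by (simp add: gn field_simps)
      then have "Im (z * g n / g i) = Im (z * g m / g i) - \<beta> m * Im (inverse (g i / g ?k))"
        by (simp only: minus_complex.simps Im_complex_of_real Re_complex_of_real times_complex.simps)
      ultimately show ?thesis
        using a b IH[of i m] i Suc by auto
    qed
    have "Im (z * g n / g m) \<ge> Im z"
      using * [of m] p Suc by simp
    then have "g n \<noteq> 0"
      using z by auto
    moreover have "Im (g n / g i) \<ge> 0 \<and> Im (z * g n / g i) \<ge> Im z" if i: "i \<le> n" "n \<le> i + p" for i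
      using *[of i] that \<open>g n \<noteq> 0\<close> Suc by (cases "i = n") auto
    ultimately show ?thesis by blast
  qed
qed

text \<open>The second inequality survives one step beyond the window of length \<open>p\<close>, because
\<open>z g\<^sub>i\<^sub>+\<^sub>p\<^sub>+\<^sub>1 / g\<^sub>i\<close> differs from \<open>z g\<^sub>i\<^sub>+\<^sub>p / g\<^sub>i\<close> by a real number. This is the case that compares
consecutive type II polynomials.\<close>
lemma sector_full_period:
  fixes z :: complex and g :: "nat \<Rightarrow> complex" and \<beta> :: "nat \<Rightarrow> real"
  assumes p: "p \<ge> 1" and z: "Im z > 0" and \<beta>: "\<And>n. \<beta> n \<ge> 0" and g0: "g 0 \<noteq> 0"
    and g: "\<And>n. g (Suc n) = g n - (if p \<le> n then \<beta> n / z * g (n - p) else 0)"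
    and i: "i \<le> n" "n \<le> i + Suc p"
  shows "Im (z * g n / g i) \<ge> Im z"
proof (cases "n \<le> i + p")
  case True
  then show ?thesis using sector_invariant[OF p z \<beta> g0 g, of n] i by blast
next
  case False
  then have n: "n = Suc (i + p)" using i by simp
  have "g i \<noteq> 0" and *: "Im (z * g (i + p) / g i) \<ge> Im z"
    using sector_invariant[OF p z \<beta> g0 g] by auto
  have "z * g n / g i = z * g (i + p) / g i - of_real (\<beta> (i + p))"
    using \<open>g i \<noteq> 0\<close> z by (simp add: n g field_simps) (auto simp: complex_eq_iff)
  then show ?thesis using * by simp
qed

definition cpoly :: "real poly \<Rightarrow> complex \<Rightarrow> complex" where
  "cpoly q z = poly (map_poly complex_of_real q) z"

lemma cpoly_0 [simp]: "cpoly 0 z = 0"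
  by (simp add: cpoly_def)

lemma cpoly_pCons [simp]: "cpoly (pCons a q) z = of_real a + z * cpoly q z"
  by (cases "a = 0 \<and> q = 0") (auto simp: cpoly_def map_poly_pCons)

lemma cpoly_simps [simp]:
  "cpoly 1 z = 1"
  "cpoly (q + r) z = cpoly q z + cpoly r z"
  "cpoly (q - r) z = cpoly q z - cpoly r z" "cpoly (Polynomial.smult c q) z = of_real c * cpoly q z"
  "cpoly (q * r) z = cpoly q z * cpoly r z"
  "cpoly q (of_real x) = of_real (poly q x)" "cpoly q (cnj z) = cnj (cpoly q z)"
proof -
  show "cpoly 1 z = 1"
    by (simp add: cpoly_def)
  show add: "cpoly (q + r) z = cpoly q z + cpoly r z" for q r
    by (induction q r rule: poly_induct2) (simp_all add: algebra_simps)
  show sm: "cpoly (Polynomial.smult c q) z = of_real c * cpoly q z" for c q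
    by (induction q) (simp_all add: algebra_simps)
  show "cpoly (q - r) z = cpoly q z - cpoly r z"
    using add[of q "Polynomial.smult (-1) r"] sm[of "-1" r] by simp
  show "cpoly (q * r) z = cpoly q z * cpoly r z"
    by (induction q) (simp_all add: add sm algebra_simps)
  show "cpoly q (of_real x) = of_real (poly q x)" "cpoly q (cnj z) = cnj (cpoly q z)"
    by (induction q) simp_all
qed

lemma sparse_poly_rational:
  fixes p :: nat and \<beta> :: "nat \<Rightarrow> real" and z :: complex
  assumes "z \<noteq> 0"
  defines "g \<equiv> \<lambda>n. cpoly (sparse_poly p \<beta> n) z / z ^ (n div Suc p)"
  shows "g (Suc n) = g n - (if p \<le> n then \<beta> n / z * g (n - p) else 0)"
proof -
  have d: "Suc n div Suc p = Suc ((n - p) div Suc p)" if "p \<le> n"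
    using that le_div_geq[of "Suc p" "Suc n"] by simp
  have "Suc n div Suc p = (if Suc p dvd Suc n then Suc (n div Suc p) else n div Suc p)"
    by (simp add: div_Suc dvd_eq_mod_eq_0)
  then have "cpoly (sparse_poly p \<beta> (Suc n)) z / z ^ (Suc n div Suc p) = g n -
    (if p \<le> n then \<beta> n * cpoly (sparse_poly p \<beta> (n - p)) z / z ^ (Suc n div Suc p) else 0)"
    using \<open>z \<noteq> 0\<close> by (auto simp: g_def diff_divide_distrib simp del: mult_pCons_left)
  also have "(if p \<le> n then \<beta> n * cpoly (sparse_poly p \<beta> (n - p)) z / z ^ (Suc n div Suc p) else 0) =
    (if p \<le> n then \<beta> n / z * g (n - p) else 0)"
    using d by (auto simp: g_def)
  finally show ?thesis
    by (simp add: g_def)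
qed

lemma sparse_poly_nonzero:
  assumes "p \<ge> 1" "\<And>n. \<beta> n \<ge> 0" "Im z > 0"
  shows "cpoly (sparse_poly p \<beta> n) z \<noteq> 0"
proof -
  have z: "z \<noteq> 0" using assms(3) by auto
  show ?thesis
    using sector_invariant[where g = "\<lambda>n. cpoly (sparse_poly p \<beta> n) z / z ^ (n div Suc p)" and n = n,
      OF assms(1) assms(3) assms(2) _ sparse_poly_rational[OF z]] by simp
qed

text \<open>With \<open>n = (N + 1) (p + 1)\<close>, the degree of \<open>f\<^sub>n\<close> exceeds that of each of the preceding
\<open>p + 1\<close> polynomials by exactly one, so that \<open>z g\<^sub>n / g\<^sub>n\<^sub>-\<^sub>k = f\<^sub>n / f\<^sub>n\<^sub>-\<^sub>k\<close>.\<close>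
lemma sparse_poly_Nevanlinna:
  assumes "p \<ge> 1" "\<And>n. \<beta> n \<ge> 0" "Im z > 0" and k: "1 \<le> k" "k \<le> Suc p"
  shows "Im (cpoly (sparse_poly p \<beta> (Suc N * Suc p)) z / cpoly (sparse_poly p \<beta> (Suc N * Suc p - k)) z)
    \<ge> Im z"
proof -
  have z: "z \<noteq> 0" using assms(3) by auto
  let ?n = "Suc N * Suc p"
  have "?n - k = N * Suc p + (Suc p - k)"
    using k by simp
  then have "(?n - k) div Suc p = N"
    using k by (simp only: div_mult_self3) simp
  moreover have "?n div Suc p = Suc N"
    by (rule nonzero_mult_div_cancel_right) simp
  ultimately show ?thesis
    using sector_full_period[where g = "\<lambda>n. cpoly (sparse_poly p \<beta> n) z / z ^ (n div Suc p)"
      and n = ?n and i = "?n - k", OF assms(1) assms(3) assms(2) _ sparse_poly_rational[OF z]] k z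
    by simp
qed

section \<open>Simple real zeros and nonnegative residues\<close>

lemma roots_real_if_nonzero_upper_half_plane:
  assumes "\<And>z. Im z > 0 \<Longrightarrow> cpoly q z \<noteq> 0" and "cpoly q z = 0"
  shows "z \<in> \<real>"
proof -
  have "\<not> Im z > 0" "\<not> Im (cnj z) > 0"
    using assms(1)[of z] assms(1)[of "cnj z"] assms(2) by auto
  then show ?thesis
    by (simp add: complex_is_Real_iff)
qed

text \<open>With \<open>F = (x - x\<^sub>0) Q\<close> and \<open>z = x\<^sub>0 + i y\<close>, the hypothesis becomes \<open>Re (Q(z) / G(z)) \<ge> 1\<close>. Clearing
the denominator gives an inequality that passes to the limit \<open>y \<rightarrow> 0\<close> even if \<open>G\<close> vanishes at
\<open>x\<^sub>0\<close>, and \<open>Q(x\<^sub>0) = F'(x\<^sub>0)\<close>.\<close>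
lemma residue_inequality:
  assumes nz: "\<And>z. Im z > 0 \<Longrightarrow> cpoly G z \<noteq> 0"
    and Nev: "\<And>z. Im z > 0 \<Longrightarrow> Im (cpoly F z / cpoly G z) \<ge> Im z"
    and root: "poly F x = 0"
  shows "(poly G x)\<^sup>2 \<le> poly (pderiv F) x * poly G x"
proof -
  obtain Q where F: "F = [:- x, 1:] * Q"
    using root by (metis dvdE poly_eq_0_iff_dvd)
  define w where "w y = complex_of_real x + \<i> * of_real y" for y :: real
  have ineq: "(cmod (cpoly G (w y)))\<^sup>2 \<le> Re (cpoly Q (w y) * cnj (cpoly G (w y)))" if "y > 0" for y
  proof -
    let ?q = "cpoly Q (w y)" and ?g = "cpoly G (w y)"
    have g: "?g \<noteq> 0" and le: "y \<le> Im (cpoly F (w y) / ?g)"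
      using nz[of "w y"] Nev[of "w y"] that by (auto simp: w_def)
    have eq: "cpoly F (w y) / ?g = \<i> * of_real y * (?q / ?g)"
      by (simp add: F w_def del: mult_pCons_left)
    have "Im (\<i> * of_real y * c) = y * Re c" for c
      by simp
    then have "y * 1 \<le> y * Re (?q / ?g)"
      using le unfolding eq by (simp only: mult_1_right)
    then have "1 \<le> Re (?q / ?g)"
      using that by (simp only: mult_le_cancel_left_pos)
    also have "?q / ?g = of_real (1 / (cmod ?g)\<^sup>2) * (?q * cnj ?g)"
      by (subst complex_div_cnj) simp
    also have "Re \<dots> = Re (?q * cnj ?g) / (cmod ?g)\<^sup>2"
      by (simp only: Re_complex_of_real Im_complex_of_real times_complex.simps) simp
    finally show ?thesis
      using g by (simp add: field_simps)
  qed
  have cont: "continuous (at_right 0) (\<lambda>y. cpoly q (w y))" for q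
    unfolding cpoly_def w_def by (intro continuous_intros)
  have lim: "((\<lambda>y. cpoly q (w y)) \<longlongrightarrow> of_real (poly q x)) (at_right 0)" for q
    using cont[of q] by (simp add: continuous_within w_def)
  have "(cmod (of_real (poly G x)))\<^sup>2 \<le> Re (of_real (poly Q x) * cnj (of_real (poly G x)))"
    by (rule tendsto_le[of "at_right (0::real)", OF _ tendsto_Re[OF tendsto_mult[OF lim[of Q] tendsto_cnj[OF lim[of G]]]]
      tendsto_power[OF tendsto_norm[OF lim[of G]]]])
      (simp, rule eventually_mono[OF eventually_at_right_less ineq])
  moreover have "poly (pderiv F) x = poly Q x"
    by (simp add: F pderiv_mult pderiv_pCons del: mult_pCons_left)
  ultimately show ?thesis
    by (simp add: power2_eq_square)
qed

lemma sparse_poly_degree_coeff: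
  "degree (sparse_poly p \<beta> n) \<le> n div Suc p \<and> coeff (sparse_poly p \<beta> n) (n div Suc p) = 1"
proof (induction n rule: less_induct)
  case (less n)
  show ?case
  proof (cases n)
    case 0
    then show ?thesis by simp
  next
    case (Suc m)
    let ?D = "Suc m div Suc p"
    let ?A = "if Suc p dvd Suc m then [:0, 1:] * sparse_poly p \<beta> m else sparse_poly p \<beta> m"
    let ?B = "if p \<le> m then Polynomial.smult (\<beta> m) (sparse_poly p \<beta> (m - p)) else 0"
    have "Suc m div Suc p = (if Suc p dvd Suc m then Suc (m div Suc p) else m div Suc p)"
      by (simp add: div_Suc dvd_eq_mod_eq_0)
    then have "degree ?A \<le> ?D" "coeff ?A ?D = 1"
      using less.IH[of m] Suc degree_pCons_le[of 0 "sparse_poly p \<beta> m"] by (auto intro: order_trans)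
    moreover have "?B = 0 \<or> degree ?B < ?D"
    proof (cases "p \<le> m")
      case True
      then have "?D = Suc ((m - p) div Suc p)"
        using le_div_geq[of "Suc p" "Suc m"] by simp
      moreover have "degree (sparse_poly p \<beta> (m - p)) \<le> (m - p) div Suc p"
        using less.IH[of "m - p"] Suc by simp
      ultimately show ?thesis
        using True degree_smult_le[of "\<beta> m" "sparse_poly p \<beta> (m - p)"] by (simp add: le_less_trans)
    qed simp
    then have "degree ?B \<le> ?D" "coeff ?B ?D = 0"
      by (auto simp del: degree_smult_eq intro: coeff_eq_0)
    ultimately have "degree (?A - ?B) \<le> ?D" "coeff (?A - ?B) ?D = 1"
      by (auto intro: degree_diff_le simp del: degree_smult_eq)
    then show ?thesis
      by (simp only: Suc sparse_poly.simps)
  qed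
qed

lemma degree_sparse_poly: "degree (sparse_poly p \<beta> n) = n div Suc p"
  using sparse_poly_degree_coeff[of p \<beta> n] by (metis le_antisym le_degree zero_neq_one)

lemma lead_coeff_sparse_poly: "lead_coeff (sparse_poly p \<beta> n) = 1"
  using sparse_poly_degree_coeff[of p \<beta> n] by (simp add: degree_sparse_poly)

lemma sparse_poly_residue:
  assumes "p \<ge> 1" "\<And>n. \<beta> n \<ge> 0" "1 \<le> k" "k \<le> Suc p"
    and "poly (sparse_poly p \<beta> (Suc N * Suc p)) x = 0"
  shows "(poly (sparse_poly p \<beta> (Suc N * Suc p - k)) x)\<^sup>2
    \<le> poly (pderiv (sparse_poly p \<beta> (Suc N * Suc p))) x * poly (sparse_poly p \<beta> (Suc N * Suc p - k)) x"
  by (rule residue_inequality)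
    (use assms sparse_poly_nonzero sparse_poly_Nevanlinna in \<open>auto simp del: mult_Suc mult_Suc_right\<close>)

text \<open>At a multiple zero of \<open>f\<^sub>n\<close> the residue inequality makes the preceding \<open>p + 1\<close> polynomials vanish as
well. Since \<open>\<beta> \<noteq> 0\<close>, the recurrence can then be run downwards and ends with \<open>f\<^sub>0 = 0\<close>, which is
absurd.\<close>
lemma sparse_poly_simple_root:
  assumes p: "p \<ge> 1" and \<beta>: "\<And>n. \<beta> n > 0"
    and root: "poly (sparse_poly p \<beta> (Suc N * Suc p)) x = 0"
  shows "poly (pderiv (sparse_poly p \<beta> (Suc N * Suc p))) x \<noteq> 0"
proof
  let ?n = "Suc N * Suc p"
  assume deriv: "poly (pderiv (sparse_poly p \<beta> ?n)) x = 0"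
  have "poly (sparse_poly p \<beta> (?n - k)) x = 0" if "k \<le> ?n" for k
    using that
  proof (induction k rule: less_induct)
    case (less k)
    consider "k = 0" | "1 \<le> k" "k \<le> Suc p" | "k > Suc p"
      by linarith
    then show ?case
    proof cases
      case 1
      then show ?thesis using root by simp
    next
      case 2
      then show ?thesis
        using sparse_poly_residue[OF p less_imp_le[OF \<beta>] 2 root] deriv
        by (simp del: mult_Suc mult_Suc_right)
    next
      case 3
      (* the recurrence step that expresses the polynomial with index ?n - k by two later ones *)
      define m where "m = ?n - k + p"
      have m: "Suc m = ?n - (k - Suc p)" "m = ?n - (k - p)" "m - p = ?n - k" "p \<le> m"
        using 3 less.prems by (auto simp: m_def)
      have "poly (sparse_poly p \<beta> (Suc m)) x = 0" "poly (sparse_poly p \<beta> m) x = 0"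
        unfolding m(1) unfolding m(2) using 3 less.prems p
        by - (rule less.IH; simp)+
      then have "\<beta> m * poly (sparse_poly p \<beta> (m - p)) x = 0"
        using m(4) by (auto split: if_splits)
      then show ?thesis
        using \<beta>[of m] by (simp add: m(3) del: mult_Suc mult_Suc_right)
    qed
  qed
  from this[of ?n] show False
    by simp
qed

lemma card_roots_eq_degree:
  assumes nz: "\<And>z. Im z > 0 \<Longrightarrow> cpoly F z \<noteq> 0"
    and simple: "\<And>x. poly F x = 0 \<Longrightarrow> poly (pderiv F) x \<noteq> 0"
  shows "card {x. poly F x = 0} = degree F"
proof -
  let ?P = "map_poly complex_of_real F"
  have "?P \<noteq> 0"
    using nz[of \<i>] by (auto simp: cpoly_def)
  have pd: "pderiv ?P = map_poly complex_of_real (pderiv F)"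
    by (rule poly_eqI) (simp add: coeff_pderiv coeff_map_poly)
  have real: "\<exists>x. z = of_real x \<and> poly F x = 0" if "poly ?P z = 0" for z
  proof -
    have "cpoly F z = 0" using that by (simp add: cpoly_def)
    then obtain x where "z = of_real x"
      using roots_real_if_nonzero_upper_half_plane[OF nz] by (auto elim: Reals_cases)
    then show ?thesis using \<open>cpoly F z = 0\<close> by auto
  qed
  have "rsquarefree ?P"
    unfolding rsquarefree_roots
  proof (intro allI notI, elim conjE)
    fix z assume z: "poly ?P z = 0" "poly (pderiv ?P) z = 0"
    then obtain x where x: "z = of_real x" "poly F x = 0"
      using real by blast
    have "cpoly (pderiv F) z = 0"
      using z(2) by (simp add: pd cpoly_def)
    then show False
      using simple[OF x(2)] x(1) by simp
  qed
  then have "?P = Polynomial.smult (lead_coeff ?P) (\<Prod>z | poly ?P z = 0. [:- z, 1:])"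
    by (rule complex_poly_decompose_rsquarefree[symmetric])
  then have "degree ?P = degree (\<Prod>z | poly ?P z = 0. [:- z, 1:])"
    using \<open>?P \<noteq> 0\<close> degree_smult_eq[of "lead_coeff ?P"] by (metis leading_coeff_0_iff)
  also have "\<dots> = card {z. poly ?P z = 0}"
    by (subst degree_prod_sum_eq) auto
  also have "{z. poly ?P z = 0} = of_real ` {x. poly F x = 0}"
  proof (intro equalityI subsetI)
    fix z assume "z \<in> {z. poly ?P z = 0}"
    then show "z \<in> of_real ` {x. poly F x = 0}"
      using real by auto
  next
    fix z assume "z \<in> complex_of_real ` {x. poly F x = 0}"
    then have "cpoly F z = 0" by auto
    then show "z \<in> {z. poly ?P z = 0}" by (simp add: cpoly_def)
  qed
  also have "card \<dots> = card {x. poly F x = 0}"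
    by (rule card_image) (simp add: inj_on_def)
  finally show ?thesis
    by (simp add: degree_map_poly)
qed

lemma card_roots_sparse_poly:
  assumes "p \<ge> 1" "\<And>n. \<beta> n > 0"
  shows "card {x. poly (sparse_poly p \<beta> (Suc N * Suc p)) x = 0} = Suc N"
proof -
  have "card {x. poly (sparse_poly p \<beta> (Suc N * Suc p)) x = 0} = degree (sparse_poly p \<beta> (Suc N * Suc p))"
    by (intro card_roots_eq_degree sparse_poly_nonzero sparse_poly_simple_root)
      (use assms in \<open>auto simp: less_imp_le\<close>)
  also have "\<dots> = Suc N"
    by (simp only: degree_sparse_poly nonzero_mult_div_cancel_right[OF Suc_not_Zero])
  finally show ?thesis .
qed

lemma poly_eq_if_agree_on_set:
  fixes P Q :: "real poly"
  assumes "finite S" "\<And>x. x \<in> S \<Longrightarrow> poly P x = poly Q x" "degree P < card S" "degree Q < card S"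
  shows "P = Q"
proof (rule ccontr)
  assume "P \<noteq> Q"
  then have "P - Q \<noteq> 0" by simp
  have "card S \<le> card {x. poly (P - Q) x = 0}"
    using assms(2) poly_roots_finite[OF \<open>P - Q \<noteq> 0\<close>] by (intro card_mono) auto
  also have "\<dots> \<le> degree (P - Q)"
    using \<open>P - Q \<noteq> 0\<close> by (rule card_poly_roots_bound)
  finally show False
    using degree_diff_le_max[of P Q] assms(3,4) by simp
qed

lemma lagrange_interpolation:
  fixes F G :: "real poly"
  defines "S \<equiv> {x. poly F x = 0}"
  assumes monic: "lead_coeff F = 1" and card: "card S = degree F" and deg: "degree G < degree F"
  shows "G = (\<Sum>x\<in>S. Polynomial.smult (poly G x / poly (pderiv F) x) (\<Prod>y\<in>S - {x}. [:- y, 1:]))"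
proof -
  have F0: "F \<noteq> 0" using monic by auto
  then have fin: "finite S" unfolding S_def by (rule poly_roots_finite)
  define L where "L x = (\<Prod>y\<in>S - {x}. [:- y, 1:])" for x
  have degL: "degree (L x) = card S - 1" if "x \<in> S" for x
    unfolding L_def using fin that by (subst degree_prod_sum_eq) auto
  have F: "F = (\<Prod>x\<in>S. [:- x, 1:])"
  proof (rule ccontr)
    let ?P = "\<Prod>x\<in>S. [:- x, 1:]"
    assume "F \<noteq> ?P"
    then have ne: "F - ?P \<noteq> 0" by simp
    have dP: "degree ?P = card S" "lead_coeff ?P = 1"
      by (subst degree_prod_sum_eq) (auto simp: lead_coeff_prod)
    have "S \<subseteq> {x. poly (F - ?P) x = 0}"
      using fin by (auto simp: S_def poly_prod)
    then have "card S \<le> card {x. poly (F - ?P) x = 0}"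
      using poly_roots_finite[OF ne] by (intro card_mono)
    also have "\<dots> \<le> degree (F - ?P)"
      using ne by (rule card_poly_roots_bound)
    finally have "degree (F - ?P) = card S"
      using degree_diff_le_max[of F ?P] dP card by simp
    moreover have "coeff F (card S) = 1"
      using card monic by simp
    moreover have "coeff ?P (card S) = 1"
      using dP by simp
    ultimately have "lead_coeff (F - ?P) = 0"
      by (simp only: coeff_diff)
    then show False using ne leading_coeff_0_iff by blast
  qed
  have FL: "F = [:- x, 1:] * L x" if "x \<in> S" for x
    unfolding L_def using fin that by (subst F) (simp add: prod.remove)
  have der: "poly (pderiv F) x = poly (L x) x" if "x \<in> S" for x
    by (subst FL[OF that]) (simp add: pderiv_mult pderiv_pCons del: mult_pCons_left)
  have Lnz: "poly (L x) x \<noteq> 0" for x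
    using fin by (simp add: L_def poly_prod)
  have Lz: "poly (L y) x = 0" if "x \<in> S" "x \<noteq> y" for x y
    using fin that by (auto simp: L_def poly_prod)
  have "G = (\<Sum>x\<in>S. Polynomial.smult (poly G x / poly (pderiv F) x) (L x))"
  proof (rule poly_eq_if_agree_on_set[OF fin])
    show "degree G < card S" using deg card by simp
    show "degree (\<Sum>x\<in>S. Polynomial.smult (poly G x / poly (pderiv F) x) (L x)) < card S"
    proof (rule le_less_trans[OF degree_sum_le[OF fin]])
      show "card S - 1 < card S" using deg card by simp
    next
      fix x assume "x \<in> S"
      then show "degree (Polynomial.smult (poly G x / poly (pderiv F) x) (L x)) \<le> card S - 1"
        using degL degree_smult_le by metis
    qed
  next
    fix x assume x: "x \<in> S"
    have "(\<Sum>y\<in>S. poly G y / poly (pderiv F) y * poly (L y) x) = poly G x / poly (pderiv F) x * poly (L x) x"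
      using x fin Lz by (subst sum.remove[OF fin x]) (auto intro!: sum.neutral)
    then show "poly G x = poly (\<Sum>x\<in>S. Polynomial.smult (poly G x / poly (pderiv F) x) (L x)) x"
      using der[OF x] Lnz[of x] by (simp add: poly_sum)
  qed
  then show ?thesis by (simp add: L_def)
qed

text \<open>Beyond the zeros of \<open>F\<close>, on either side, all the products in the interpolation formula for \<open>G\<close> have
the same sign, so that nothing can cancel.\<close>
lemma roots_within_hull:
  fixes F G :: "real poly"
  defines "S \<equiv> {x. poly F x = 0}"
  assumes monic: "lead_coeff F = 1" and card: "card S = degree F" and deg: "degree G < degree F"
    and pos: "\<And>x. x \<in> S \<Longrightarrow> poly G x / poly (pderiv F) x \<ge> 0"
    and G0: "G \<noteq> 0" and root: "poly G t = 0"
  shows "Min S \<le> t \<and> t \<le> Max S"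
proof -
  have F0: "F \<noteq> 0" using monic by auto
  then have fin: "finite S" unfolding S_def by (rule poly_roots_finite)
  have ne: "S \<noteq> {}" using card deg by auto
  define w where "w x = poly G x / poly (pderiv F) x" for x
  have G: "G = (\<Sum>x\<in>S. Polynomial.smult (w x) (\<Prod>y\<in>S - {x}. [:- y, 1:]))"
    using lagrange_interpolation[OF monic card[unfolded S_def] deg] by (simp add: S_def w_def)
  have "\<exists>x\<in>S. w x \<noteq> 0"
    using G G0 by (metis (no_types, lifting) smult_0_left sum.neutral)
  then obtain x0 where x0: "x0 \<in> S" "w x0 > 0"
    using pos by (force simp: w_def order_less_le)
  have eval: "poly G t = (\<Sum>x\<in>S. w x * (\<Prod>y\<in>S - {x}. t - y))"
    by (subst G) (simp add: poly_sum poly_prod)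
  have "t \<le> Max S"
  proof (rule ccontr)
    assume "\<not> t \<le> Max S"
    then have gt: "y < t" if "y \<in> S" for y
      using that fin by (meson Max_ge not_le order.strict_trans1)
    have "0 < (\<Sum>x\<in>S. w x * (\<Prod>y\<in>S - {x}. t - y))"
      using fin x0 pos gt
      by (intro sum_pos2[of _ x0] mult_pos_pos mult_nonneg_nonneg prod_pos prod_nonneg)
        (auto simp: w_def less_imp_le)
    then show False using eval root by simp
  qed
  moreover have "Min S \<le> t"
  proof (rule ccontr)
    assume "\<not> Min S \<le> t"
    then have gt: "t < y" if "y \<in> S" for y
      using that fin by (meson Min_le not_le order.strict_trans2)
    have "(\<Prod>y\<in>S - {x}. t - y) = (-1) ^ (card S - 1) * (\<Prod>y\<in>S - {x}. y - t)" if "x \<in> S" for x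
    proof -
      have "(\<Prod>y\<in>S - {x}. t - y) = (\<Prod>y\<in>S - {x}. (-1) * (y - t))" by simp
      also have "\<dots> = (-1) ^ (card S - 1) * (\<Prod>y\<in>S - {x}. y - t)"
        using fin that by (subst prod.distrib) simp
      finally show ?thesis .
    qed
    then have "poly G t = (-1) ^ (card S - 1) * (\<Sum>x\<in>S. w x * (\<Prod>y\<in>S - {x}. y - t))"
      unfolding eval sum_distrib_left by (intro sum.cong) (auto simp: algebra_simps)
    moreover have "0 < (\<Sum>x\<in>S. w x * (\<Prod>y\<in>S - {x}. y - t))"
      using fin x0 pos gt
      by (intro sum_pos2[of _ x0] mult_pos_pos mult_nonneg_nonneg prod_pos prod_nonneg)
        (auto simp: w_def less_imp_le)
    ultimately show False using root by simp
  qed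
  ultimately show ?thesis by simp
qed

section \<open>Forward and backward sequences\<close>

text \<open>For \<open>n \<ge> p\<close>, the only case that enters, the coefficient is \<open>\<alpha>\<^sub>n\<^sub>+\<^sub>1\<^sub>-\<^sub>p\<close>. Truncated subtraction inside
\<open>Suc\<close> makes it positive for every \<open>n\<close>.\<close>
definition forward_poly :: "nat \<Rightarrow> (nat \<Rightarrow> real) \<Rightarrow> nat \<Rightarrow> real poly" where
  "forward_poly p \<alpha> = sparse_poly p (\<lambda>n. \<alpha> (Suc (n - p)))"

text \<open>The polynomial with index \<open>j (p + 1) + k + 1\<close>, for \<open>0 \<le> k \<le> p\<close>, is entry \<open>j\<close> of \<open>v L\<^sub>1 \<cdots> L\<^sub>k\<close>,
where \<open>v\<close> is the left eigenvector, normalized by \<open>v\<^sub>N = 1\<close>, of the truncation of size \<open>N + 1\<close>.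
Index \<open>0\<close> carries the characteristic polynomial. The value \<open>0\<close> beyond index \<open>(N + 1) (p + 1)\<close>
stands for the missing entries of \<open>v\<close>.\<close>
definition backward_poly :: "nat \<Rightarrow> (nat \<Rightarrow> real) \<Rightarrow> nat \<Rightarrow> nat \<Rightarrow> real poly" where
  "backward_poly p \<alpha> N m = (if m \<le> Suc N * Suc p
     then sparse_poly p (\<lambda>n. \<alpha> (Suc (Suc N * Suc p - Suc n))) (Suc N * Suc p - m) else 0)"

text \<open>Multiplication by one factor \<open>L\<^sub>k\<close>: up to the factor \<open>x\<close>, the polynomials with indices
\<open>i (p + 1) + k\<close> are the entries of \<open>L\<^sub>k\<^sub>+\<^sub>1 \<cdots> L\<^sub>p U B\<close>.\<close>
lemma forward_within_block:
  assumes "1 \<le> k" "k \<le> p"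
  shows "poly (forward_poly p \<alpha> (i * Suc p + (k - 1))) x = poly (forward_poly p \<alpha> (i * Suc p + k)) x
    + (if i = 0 then 0 else \<alpha> (k + 1 + (i - 1) * (p + 1)) * poly (forward_poly p \<alpha> ((i - 1) * Suc p + k)) x)"
proof -
  define n where "n = i * Suc p + (k - 1)"
  have n: "i * Suc p + k = Suc n" using assms by (simp add: n_def)
  have "\<not> Suc p dvd k"
    using assms by (auto dest: dvd_imp_le)
  then have "\<not> Suc p dvd Suc n"
    unfolding n[symmetric] by (metis dvd_add_right_iff dvd_triv_right)
  moreover have "p \<le> n \<longleftrightarrow> i \<noteq> 0"
    using assms by (cases i) (auto simp: n_def)
  moreover have "n - p = (i - 1) * Suc p + k" if "i \<noteq> 0"
    using assms that by (cases i) (auto simp: n_def)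
  ultimately show ?thesis
    unfolding n n_def[symmetric] by (auto simp: forward_poly_def algebra_simps)
qed

text \<open>Multiplication by the factor \<open>U\<close>.\<close>
lemma forward_end_of_block:
  "x * poly (forward_poly p \<alpha> (i * Suc p + p)) x =
    \<alpha> (1 + i * (p + 1)) * poly (forward_poly p \<alpha> (i * Suc p)) x + poly (forward_poly p \<alpha> (Suc i * Suc p)) x"
proof -
  define n where "n = i * Suc p + p"
  have n: "Suc i * Suc p = Suc n" "n - p = i * Suc p" "p \<le> n"
    by (auto simp: n_def)
  have "Suc p dvd Suc n"
    by (simp only: n(1)[symmetric] dvd_triv_right)
  then show ?thesis
    unfolding n(1) n_def[symmetric] using n(2,3) by (simp add: forward_poly_def)
qed

lemma backward_step:
  assumes "m < Suc N * Suc p"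
  shows "poly (backward_poly p \<alpha> N m) x = (if Suc p dvd m then x * poly (backward_poly p \<alpha> N (Suc m)) x else poly (backward_poly p \<alpha> N (Suc m)) x)
    - \<alpha> (Suc m) * poly (backward_poly p \<alpha> N (m + Suc p)) x"
proof -
  let ?M = "Suc N * Suc p"
  define n where "n = ?M - Suc m"
  have n: "?M - m = Suc n" "?M - Suc n = m" "p \<le> n \<longleftrightarrow> m + Suc p \<le> ?M" "n - p = ?M - (m + Suc p)"
    using assms by (auto simp: n_def simp del: mult_Suc mult_Suc_right)
  have "Suc p dvd Suc n \<longleftrightarrow> Suc p dvd m"
    unfolding n(1)[symmetric] using assms
    by (metis dvd_diff_nat dvd_diffD1 dvd_triv_right less_imp_le)
  then show ?thesis
    using assms n by (auto simp: backward_poly_def n_def[symmetric] simp del: mult_Suc mult_Suc_right)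
qed

lemma backward_within_block:
  assumes "1 \<le> k" "k \<le> p"
  shows "poly (backward_poly p \<alpha> N (i * Suc p + k + 1)) x = poly (backward_poly p \<alpha> N (i * Suc p + k)) x
    + \<alpha> (k + 1 + i * (p + 1)) * poly (backward_poly p \<alpha> N (Suc i * Suc p + k)) x"
proof (cases "i * Suc p + k < Suc N * Suc p")
  case True
  have "\<not> Suc p dvd k"
    using assms by (auto dest: dvd_imp_le)
  then have "\<not> Suc p dvd i * Suc p + k"
    by (metis dvd_add_right_iff dvd_triv_right)
  then show ?thesis
    using backward_step[OF True] by (simp add: algebra_simps)
next
  case False
  have "i * Suc p + k \<noteq> Suc N * Suc p"
  proof
    assume "i * Suc p + k = Suc N * Suc p"
    then have "(i * Suc p + k) mod Suc p = 0" by (simp only: mod_mult_self2_is_0)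
    then have "k mod Suc p = 0" by (simp only: mod_mult_self3)
    then show False using assms by simp
  qed
  then show ?thesis
    using False by (auto simp: backward_poly_def)
qed

lemma smat_mult_lower_factor:
  "smat_mult (lower_factor p \<alpha> k) M i j =
    M i j + (if i = 0 then 0 else \<alpha> (k + 1 + (i - 1) * (p + 1)) * M (i - 1) j)"
proof -
  have "smat_mult (lower_factor p \<alpha> k) M i j = (\<Sum>l\<in>{i, i - 1}. lower_factor p \<alpha> k i l * M l j)"
    unfolding smat_mult_def
    by (rule sum.mono_neutral_left) (auto simp: lower_factor_def split: if_splits)
  also have "\<dots> = M i j + (if i = 0 then 0 else \<alpha> (k + 1 + (i - 1) * (p + 1)) * M (i - 1) j)"
    by (cases i) (auto simp: lower_factor_def)
  finally show ?thesis .
qed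

text \<open>The superdiagonal entries \<open>1\<close> let the recurrence determine each entry of a right eigenvector from the
preceding ones.\<close>
lemma hessenberg_recurrence_zero:
  fixes u :: "nat \<Rightarrow> real"
  assumes T: "\<And>n. T n (Suc n) = 1" and u0: "u 0 = 0"
    and rec: "\<And>n. n < N \<Longrightarrow> (\<Sum>j\<le>Suc n. T n j * u j) = x * u n"
  shows "j \<le> N \<Longrightarrow> u j = 0"
proof (induction j rule: less_induct)
  case (less j)
  show ?case
  proof (cases j)
    case (Suc n)
    have "(\<Sum>i\<le>n. T n i * u i) = 0"
      using less Suc by (intro sum.neutral) simp
    then show ?thesis
      using rec[of n] less Suc T by simp
  qed (simp add: u0)
qed

section \<open>Type II polynomials as a forward sequence\<close>

locale bidiagonal_hessenberg =
  fixes p :: nat and T :: smat and \<alpha> :: "nat \<Rightarrow> real"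
  assumes p: "p \<ge> 1"
    and hess: "monic_banded_Hessenberg p T"
    and pbf: "positive_bidiagonal_factorization p T \<alpha>"
begin

abbreviation B :: "nat \<Rightarrow> real poly" where
  "B \<equiv> type_II_poly p T"

abbreviation nodes :: "nat \<Rightarrow> real set" where
  "nodes N \<equiv> {x. poly (B (Suc N)) x = 0}"

lemma \<alpha>_pos: "\<alpha> (Suc n) > 0"
  using pbf by (simp add: positive_bidiagonal_factorization_def)

lemma T_superdiagonal: "T n (Suc n) = 1"
  and T_above: "j > i + 1 \<Longrightarrow> T i j = 0"
  and T_below: "j + p < i \<Longrightarrow> T i j = 0"
  and T_corner: "T (n + p) n \<noteq> 0"
proof -
  show "T n (Suc n) = 1" "j > i + 1 \<Longrightarrow> T i j = 0" "j + p < i \<Longrightarrow> T i j = 0"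
    using hess unfolding monic_banded_Hessenberg_def by blast+
  have "T (n + p) (n + p - p) \<noteq> 0"
    using hess le_add2 unfolding monic_banded_Hessenberg_def by blast
  then show "T (n + p) n \<noteq> 0" by simp
qed

text \<open>The partial products \<open>L\<^sub>k \<cdots> L\<^sub>p U\<close>, through which the equation
\<open>T B = x B\<close> is verified one factor at a time.\<close>
definition factor_tail :: "nat \<Rightarrow> smat" where
  "factor_tail k = foldr (\<lambda>k M. smat_mult (lower_factor p \<alpha> k) M) [k..<Suc p] (upper_factor p \<alpha>)"

lemma T_eq_factor_tail: "T = factor_tail 1"
  using pbf by (simp add: positive_bidiagonal_factorization_def factor_tail_def)

lemma factor_tail_Suc_p: "factor_tail (Suc p) = upper_factor p \<alpha>"
  by (simp add: factor_tail_def)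

lemma factor_tail_step:
  "k \<le> p \<Longrightarrow> factor_tail k i j = factor_tail (Suc k) i j
     + (if i = 0 then 0 else \<alpha> (k + 1 + (i - 1) * (p + 1)) * factor_tail (Suc k) (i - 1) j)"
  by (simp add: factor_tail_def upt_conv_Cons smat_mult_lower_factor del: upt_Suc)

lemma factor_tail_above:
  assumes "k \<le> Suc p"
  shows "j > Suc i \<Longrightarrow> factor_tail k i j = 0"
  using assms
proof (induction k arbitrary: i rule: inc_induct)
  case base
  then show ?case by (simp add: factor_tail_Suc_p upper_factor_def)
next
  case (step k)
  then show ?case by (simp add: factor_tail_step)
qed

lemma factor_tail_forward:
  assumes "k \<le> Suc p" "1 \<le> k"
  shows "(\<Sum>j\<le>Suc i. factor_tail k i j * poly (forward_poly p \<alpha> (j * Suc p)) x) = x * poly (forward_poly p \<alpha> (i * Suc p + (k - 1))) x"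
  using assms
proof (induction k arbitrary: i rule: inc_induct)
  case base
  have "(\<Sum>j\<le>Suc i. factor_tail (Suc p) i j * poly (forward_poly p \<alpha> (j * Suc p)) x)
    = (\<Sum>j\<in>{i, Suc i}. factor_tail (Suc p) i j * poly (forward_poly p \<alpha> (j * Suc p)) x)"
    by (rule sum.mono_neutral_right) (auto simp: factor_tail_Suc_p upper_factor_def)
  also have "\<dots> = x * poly (forward_poly p \<alpha> (i * Suc p + (Suc p - 1))) x"
    using forward_end_of_block[of x p \<alpha> i] by (simp add: factor_tail_Suc_p upper_factor_def)
  finally show ?case .
next
  case (step k)
  let ?b = "\<lambda>j. poly (forward_poly p \<alpha> (j * Suc p)) x"
  have k: "1 \<le> k" "k \<le> p" using step by auto
  have IH: "(\<Sum>j\<le>Suc i. factor_tail (Suc k) i j * ?b j) = x * poly (forward_poly p \<alpha> (i * Suc p + k)) x" for i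
    using step.IH by simp
  have *: "(\<Sum>j\<le>Suc i. factor_tail (Suc k) (i - 1) j * ?b j) = x * poly (forward_poly p \<alpha> ((i - 1) * Suc p + k)) x" if "i \<noteq> 0"
  proof -
    have "(\<Sum>j\<le>Suc i. factor_tail (Suc k) (i - 1) j * ?b j) = (\<Sum>j\<le>i. factor_tail (Suc k) (i - 1) j * ?b j)"
      using that k by (simp add: factor_tail_above)
    then show ?thesis
      using IH[of "i - 1"] that by simp
  qed
  have "(\<Sum>j\<in>S. factor_tail k i j * ?b j) = (\<Sum>j\<in>S. factor_tail (Suc k) i j * ?b j)
      + (if i = 0 then 0 else \<alpha> (k + 1 + (i - 1) * (p + 1)) * (\<Sum>j\<in>S. factor_tail (Suc k) (i - 1) j * ?b j))" for S
    unfolding factor_tail_step[OF k(2)] by (simp add: distrib_right sum.distrib sum_distrib_left mult.assoc)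
  then have "(\<Sum>j\<le>Suc i. factor_tail k i j * ?b j) = (\<Sum>j\<le>Suc i. factor_tail (Suc k) i j * ?b j)
      + (if i = 0 then 0 else \<alpha> (k + 1 + (i - 1) * (p + 1)) * (\<Sum>j\<le>Suc i. factor_tail (Suc k) (i - 1) j * ?b j))" .
  also have "\<dots> = x * poly (forward_poly p \<alpha> (i * Suc p + (k - 1))) x"
    unfolding forward_within_block[OF k] IH using * by (simp add: algebra_simps)
  finally show ?case .
qed

lemma type_II_recurrence: "(\<Sum>j\<le>Suc n. T n j * poly (B j) x) = x * poly (B n) x"
proof -
  have "(\<Sum>k\<in>{1..min p n}. T n (n - k) * poly (B (n - k)) x) = (\<Sum>k\<in>{1..n}. T n (n - k) * poly (B (n - k)) x)"
    by (rule sum.mono_neutral_left) (auto simp: T_below)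
  also have "\<dots> = (\<Sum>j<n. T n j * poly (B j) x)"
    by (rule sum.reindex_bij_witness[where i = "\<lambda>j. n - j" and j = "\<lambda>k. n - k"]) auto
  finally have "poly (B (Suc n)) x = x * poly (B n) x - T n n * poly (B n) x - (\<Sum>j<n. T n j * poly (B j) x)"
    by (simp add: poly_sum algebra_simps)
  moreover have "(\<Sum>j\<le>n. f j) = (\<Sum>j<n. f j) + f n" for f :: "nat \<Rightarrow> real"
    by (metis lessThan_Suc_atMost sum.lessThan_Suc)
  ultimately show ?thesis
    by (simp add: T_superdiagonal del: type_II_poly.simps)
qed

text \<open>Both sides satisfy \<open>T u = x u\<close> with \<open>u\<^sub>0 = 1\<close>.\<close>
lemma type_II_poly_eq_forward: "B n = forward_poly p \<alpha> (n * Suc p)"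
proof -
  have "poly (B n) x = poly (forward_poly p \<alpha> (n * Suc p)) x" for x
  proof -
    have "poly (B n) x - poly (forward_poly p \<alpha> (n * Suc p)) x = 0"
    proof (rule hessenberg_recurrence_zero[where N = n and T = T and x = x
        and u = "\<lambda>j. poly (B j) x - poly (forward_poly p \<alpha> (j * Suc p)) x"])
      fix m
      have "(\<Sum>j\<le>Suc m. factor_tail 1 m j * poly (forward_poly p \<alpha> (j * Suc p)) x) = x * poly (forward_poly p \<alpha> (m * Suc p + (1 - 1))) x"
        by (rule factor_tail_forward) auto
      then have "(\<Sum>j\<le>Suc m. T m j * poly (forward_poly p \<alpha> (j * Suc p)) x) = x * poly (forward_poly p \<alpha> (m * Suc p)) x"
        by (simp only: T_eq_factor_tail[symmetric] diff_self_eq_0 add_0_right)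
      then show "(\<Sum>j\<le>Suc m. T m j * (poly (B j) x - poly (forward_poly p \<alpha> (j * Suc p)) x))
        = x * (poly (B m) x - poly (forward_poly p \<alpha> (m * Suc p)) x)"
        by (simp only: right_diff_distrib sum_subtractf type_II_recurrence)
    qed (auto simp: T_superdiagonal forward_poly_def)
    then show ?thesis by simp
  qed
  then show ?thesis
    by (simp add: poly_eq_poly_eq_iff[symmetric] fun_eq_iff)
qed

end

section \<open>The spectra of the truncations\<close>

(* From here on the recurrences enter only through the lemmas above. *)
declare type_II_poly.simps(2) [simp del] sparse_poly.simps(2) [simp del]

lemma sum_atMost_shift:
  fixes t :: "nat \<Rightarrow> real"
  shows "(\<Sum>i\<le>N. if i = 0 then 0 else t (i - 1)) = (\<Sum>i<N. t i)"
  by (induction N) auto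

context bidiagonal_hessenberg
begin

lemma trunc_row_sum:
  assumes "i \<le> N" "u (Suc N) = 0"
  shows "(\<Sum>j<Suc N. T i j * u j) = (\<Sum>j\<le>Suc i. T i j * u j)"
proof -
  have "(\<Sum>j<Suc N. T i j * u j) = (\<Sum>j\<le>Suc N. T i j * u j)"
    using assms(2) by (simp add: lessThan_Suc_atMost)
  also have "\<dots> = (\<Sum>j\<le>Suc i. T i j * u j)"
    using assms(1) by (intro sum.mono_neutral_right) (auto simp: T_above)
  finally show ?thesis .
qed

lemma trunc_mult_vec:
  assumes "v \<in> carrier_vec (Suc N)" "i \<le> N"
  shows "vec_index (trunc N T *\<^sub>v v) i = (\<Sum>j<Suc N. T i j * vec_index v j)"
  using assms by (simp add: trunc_def scalar_prod_def atLeast0LessThan)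

lemma node_row_sum:
  assumes "x \<in> nodes N" "i \<le> N"
  shows "(\<Sum>j<Suc N. T i j * poly (B j) x) = x * poly (B i) x"
  using trunc_row_sum[of i N "\<lambda>j. poly (B j) x"] type_II_recurrence[of i x] assms
  by simp

lemma eigenvalues_trunc: "{x. eigenvalue (trunc N T) x} = nodes N"
proof (intro equalityI subsetI)
  fix x assume x: "x \<in> nodes N"
  let ?v = "Matrix.vec (Suc N) (\<lambda>j. poly (B j) x)"
  have "vec_index ?v 0 = 1" by simp
  then have "?v \<noteq> 0\<^sub>v (Suc N)" by (metis index_zero_vec(1) zero_less_Suc zero_neq_one)
  moreover have "trunc N T *\<^sub>v ?v = x \<cdot>\<^sub>v ?v"
  proof (rule eq_vecI)
    fix i assume "i < dim_vec (x \<cdot>\<^sub>v ?v)"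
    then have i: "i \<le> N" by simp
    have "vec_index (trunc N T *\<^sub>v ?v) i = (\<Sum>j<Suc N. T i j * poly (B j) x)"
      by (subst trunc_mult_vec[OF _ i]) (simp, intro sum.cong, auto)
    then show "vec_index (trunc N T *\<^sub>v ?v) i = vec_index (x \<cdot>\<^sub>v ?v) i"
      using node_row_sum[OF x i] i by simp
  qed (simp add: trunc_def)
  ultimately have "eigenvector (trunc N T) ?v x"
    by (simp add: eigenvector_def trunc_def)
  then show "x \<in> {x. eigenvalue (trunc N T) x}"
    by (auto simp: eigenvalue_def)
next
  fix x assume "x \<in> {x. eigenvalue (trunc N T) x}"
  then obtain v where v: "v \<in> carrier_vec (Suc N)" "v \<noteq> 0\<^sub>v (Suc N)"
      and ev: "trunc N T *\<^sub>v v = x \<cdot>\<^sub>v v"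
    by (auto simp: eigenvalue_def eigenvector_def trunc_def)
  define u where "u j = (if j \<le> N then vec_index v j else 0)" for j
  have rec: "(\<Sum>j\<le>Suc i. T i j * u j) = x * u i" if "i \<le> N" for i
  proof -
    have "(\<Sum>j\<le>Suc i. T i j * u j) = (\<Sum>j<Suc N. T i j * u j)"
      using trunc_row_sum[of i N u] that by (simp add: u_def)
    also have "\<dots> = (\<Sum>j<Suc N. T i j * vec_index v j)"
      by (intro sum.cong) (auto simp: u_def)
    also have "\<dots> = x * vec_index v i"
      using trunc_mult_vec[OF v(1) that] ev v(1) that by simp
    finally show ?thesis using that by (simp add: u_def)
  qed
  have proportional: "u j - u 0 * poly (B j) x = 0" if "j \<le> Suc N" for j
  proof (rule hessenberg_recurrence_zero[where N = "Suc N" and T = T and x = x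
      and u = "\<lambda>j. u j - u 0 * poly (B j) x"])
    fix n assume "n < Suc N"
    have "(\<Sum>j\<le>Suc n. T n j * (u j - u 0 * poly (B j) x))
      = (\<Sum>j\<le>Suc n. T n j * u j) - u 0 * (\<Sum>j\<le>Suc n. T n j * poly (B j) x)"
      unfolding sum_distrib_left sum_subtractf[symmetric] by (intro sum.cong) (auto simp: algebra_simps)
    then show "(\<Sum>j\<le>Suc n. T n j * (u j - u 0 * poly (B j) x)) = x * (u n - u 0 * poly (B n) x)"
      using rec[of n] \<open>n < Suc N\<close> unfolding type_II_recurrence by (simp add: algebra_simps)
  qed (use that in \<open>simp_all add: T_superdiagonal\<close>)
  have "u 0 \<noteq> 0"
  proof
    assume "u 0 = 0"
    then have "vec_index v j = 0" if "j \<le> N" for j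
      using proportional[of j] that by (simp add: u_def)
    then have "v = 0\<^sub>v (Suc N)"
      using v(1) by (intro eq_vecI) auto
    then show False using v(2) by simp
  qed
  moreover have "u (Suc N) = 0" by (simp add: u_def)
  ultimately show "x \<in> nodes N"
    using proportional[of "Suc N"] by simp
qed

lemma card_nodes: "card (nodes N) = Suc N"
  unfolding type_II_poly_eq_forward forward_poly_def
  by (rule card_roots_sparse_poly[OF p]) (rule \<alpha>_pos)

lemma finite_nodes: "finite (nodes N)" and nodes_nonempty: "nodes N \<noteq> {}"
  using card_nodes[of N] by (metis card.infinite nat.distinct(1), metis card.empty nat.distinct(1))

lemma lead_coeff_type_II: "lead_coeff (B n) = 1"
  and degree_type_II: "degree (B n) = n"
  unfolding type_II_poly_eq_forward forward_poly_def
  by (rule lead_coeff_sparse_poly) (simp only: degree_sparse_poly nonzero_mult_div_cancel_right[OF Suc_not_Zero])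

text \<open>This is monotonicity of both extreme eigenvalues in \<open>N\<close> at once: the residue inequality for
\<open>B\<^sub>N\<^sub>+\<^sub>2\<close> and \<open>B\<^sub>N\<^sub>+\<^sub>1\<close>, which are \<open>p + 1\<close> steps apart in the forward sequence.\<close>
lemma nodes_within_next_hull:
  assumes "x \<in> nodes N"
  shows "Min (nodes (Suc N)) \<le> x \<and> x \<le> Max (nodes (Suc N))"
proof (rule roots_within_hull[where G = "B (Suc N)"])
  fix y assume "y \<in> nodes (Suc N)"
  moreover have "B (Suc N) = sparse_poly p (\<lambda>n. \<alpha> (Suc (n - p))) (Suc (Suc N) * Suc p - Suc p)"
    by (simp add: type_II_poly_eq_forward forward_poly_def)
  ultimately have "(poly (B (Suc N)) y)\<^sup>2 \<le> poly (pderiv (B (Suc (Suc N)))) y * poly (B (Suc N)) y"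
    using sparse_poly_residue[OF p, of "\<lambda>n. \<alpha> (Suc (n - p))" "Suc p" "Suc N" y] \<alpha>_pos
    unfolding type_II_poly_eq_forward[of "Suc (Suc N)"] forward_poly_def by (simp add: less_imp_le del: mult_Suc mult_Suc_right)
  then have "0 \<le> poly (pderiv (B (Suc (Suc N)))) y * poly (B (Suc N)) y"
    by (rule order_trans[OF zero_le_power2])
  then show "0 \<le> poly (B (Suc N)) y / poly (pderiv (B (Suc (Suc N)))) y"
    by (auto simp: zero_le_mult_iff zero_le_divide_iff)
next
  show "B (Suc N) \<noteq> 0"
    using lead_coeff_type_II[of "Suc N"] by auto
next
  show "poly (B (Suc N)) x = 0" using assms by simp
qed (simp_all only: lead_coeff_type_II card_nodes, simp_all only: degree_type_II lessI)

lemma smallest_eigenvalue_eq: "smallest_eigenvalue T N = Min (nodes N)"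
  and largest_eigenvalue_eq: "largest_eigenvalue T N = Max (nodes N)"
  by (simp_all only: smallest_eigenvalue_def largest_eigenvalue_def eigenvalues_trunc)

lemma bounded_row_sums:
  assumes "smat_norm_inf T < \<infinity>"
  obtains R where "\<And>i N. (\<Sum>j<N. \<bar>T i j\<bar>) \<le> R"
proof -
  obtain R where R: "smat_norm_inf T = ennreal R" "R \<ge> 0"
    using assms by (metis ennreal_cases less_irrefl infinity_ennreal_def)
  have "(\<Sum>j<N. \<bar>T i j\<bar>) \<le> R" for i N
  proof -
    have "ennreal (\<Sum>j<N. \<bar>T i j\<bar>) = (\<Sum>j<N. ennreal \<bar>T i j\<bar>)"
      by (rule sum_ennreal[symmetric]) simp
    also have "\<dots> \<le> (\<Sum>j. ennreal \<bar>T i j\<bar>)"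
      by (rule sum_le_suminf) auto
    also have "\<dots> \<le> smat_norm_inf T"
      unfolding smat_norm_inf_def by (rule SUP_upper) simp
    finally show ?thesis
      using R by simp
  qed
  then show ?thesis by (rule that)
qed

text \<open>Evaluate \<open>T u = x u\<close> at an entry of \<open>u = (B\<^sub>j(x))\<^sub>j\<close> of largest modulus,
which is not zero because \<open>B\<^sub>0 = 1\<close>.\<close>
lemma node_bounded:
  assumes R: "\<And>i N. (\<Sum>j<N. \<bar>T i j\<bar>) \<le> R" and x: "x \<in> nodes N"
  shows "\<bar>x\<bar> \<le> R"
proof -
  let ?b = "\<lambda>j. \<bar>poly (B j) x\<bar>"
  have "Max (?b ` {..N}) \<in> ?b ` {..N}"
    by (rule Max_in) auto
  then obtain i where "i \<in> {..N}" and max_i: "Max (?b ` {..N}) = ?b i"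
    by (rule imageE)
  then have i: "i \<le> N" by simp
  then have max: "?b j \<le> ?b i" if "j \<le> N" for j
    unfolding max_i[symmetric] using that by (intro Max_ge) auto
  have "?b i > 0"
    using max[of 0] by simp
  have "\<bar>x\<bar> * ?b i = \<bar>\<Sum>j<Suc N. T i j * poly (B j) x\<bar>"
    using node_row_sum[OF x i] by (simp add: abs_mult)
  also have "\<dots> \<le> (\<Sum>j<Suc N. \<bar>T i j\<bar> * ?b i)"
    by (rule order_trans[OF sum_abs], rule sum_mono) (simp add: abs_mult mult_left_mono max)
  also have "\<dots> \<le> R * ?b i"
    using R[of i "Suc N"] unfolding sum_distrib_right[symmetric] by (intro mult_right_mono) auto
  finally show ?thesis
    using \<open>?b i > 0\<close> by simp
qed

text \<open>Boundedness of \<open>T\<close> makes the monotone sequences of extreme eigenvalues converge, so that the limits in the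
definition of \<open>Delta\<close> are bounds for them.\<close>
lemma nodes_subset_Delta:
  assumes "smat_norm_inf T < \<infinity>"
  shows "nodes N \<subseteq> Delta T"
proof
  fix x assume x: "x \<in> nodes N"
  obtain R where R: "\<And>i N. (\<Sum>j<N. \<bar>T i j\<bar>) \<le> R"
    using bounded_row_sums[OF assms] by blast
  have in_nodes: "smallest_eigenvalue T N \<in> nodes N" "largest_eigenvalue T N \<in> nodes N" for N
    unfolding smallest_eigenvalue_eq largest_eigenvalue_eq
    by (rule Min_in[OF finite_nodes nodes_nonempty] Max_in[OF finite_nodes nodes_nonempty])+
  have bnd: "\<bar>smallest_eigenvalue T N\<bar> \<le> R" "\<bar>largest_eigenvalue T N\<bar> \<le> R" for N
    using node_bounded[OF R] in_nodes by blast+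
  have dec: "decseq (smallest_eigenvalue T)"
    unfolding decseq_Suc_iff using nodes_within_next_hull in_nodes smallest_eigenvalue_eq by metis
  have inc: "incseq (largest_eigenvalue T)"
    unfolding incseq_Suc_iff using nodes_within_next_hull in_nodes largest_eigenvalue_eq by metis
  have "smallest_eigenvalue T \<longlonglongrightarrow> lim (smallest_eigenvalue T)"
    using bnd dec by (metis Bseq_monoseq_convergent BseqI' convergent_LIMSEQ_iff monoseq_iff real_norm_def)
  then have "lim (smallest_eigenvalue T) \<le> smallest_eigenvalue T N"
    using dec by (simp add: decseq_ge)
  moreover have "largest_eigenvalue T \<longlonglongrightarrow> lim (largest_eigenvalue T)"
    using bnd inc by (metis Bseq_monoseq_convergent BseqI' convergent_LIMSEQ_iff monoseq_iff real_norm_def)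
  then have "largest_eigenvalue T N \<le> lim (largest_eigenvalue T)"
    using inc by (simp add: incseq_le)
  moreover have "smallest_eigenvalue T N \<le> x" "x \<le> largest_eigenvalue T N"
    unfolding smallest_eigenvalue_eq largest_eigenvalue_eq using finite_nodes x by auto
  ultimately show "x \<in> Delta T"
    by (simp add: Delta_def)
qed

section \<open>Duality of left and right eigenvectors\<close>

abbreviation H :: "nat \<Rightarrow> nat \<Rightarrow> real poly" where
  "H \<equiv> backward_poly p \<alpha>"

text \<open>The number \<open>v(x) (L\<^sub>1 \<cdots> L\<^sub>k) (L\<^sub>k\<^sub>+\<^sub>1 \<cdots> L\<^sub>p U) B(y)\<close> does not depend on \<open>k\<close>. For \<open>k = 0\<close> it is \<open>y\<close> times
\<open>v(x) B(y)\<close>, and for \<open>k = p\<close>, absorbing \<open>U\<close> into the left factor gives \<open>x\<close> times \<open>v(x) B(y)\<close> up to the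
two boundary terms on the right-hand side. In the proof, \<open>V k\<close> is this number divided by \<open>y\<close>.\<close>
lemma Christoffel_Darboux:
  "(x - y) * (\<Sum>i\<le>N. poly (H N (i * Suc p + 1)) x * poly (B i) y) = poly (H N 0) x - poly (B (Suc N)) y"
proof -
  let ?q = "Suc p"
  let ?h = "\<lambda>m. poly (H N m) x" and ?f = "\<lambda>m. poly (forward_poly p \<alpha> m) y"
  define V where "V k = (\<Sum>i\<le>N. ?h (i * ?q + k + 1) * ?f (i * ?q + k))" for k
  have step: "V (k - 1) = V k" if k: "1 \<le> k" "k \<le> p" for k
  proof -
    define t where "t i = \<alpha> (k + 1 + i * (p + 1)) * ?h (Suc i * ?q + k) * ?f (i * ?q + k)" for i
    have "Suc N * ?q + k > Suc N * ?q" using k by simp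
    then have "t N = 0"
      by (simp add: t_def backward_poly_def del: mult_Suc mult_Suc_right)
    have h: "?h (i * ?q + (k - 1) + 1) * ?f (i * ?q + (k - 1)) =
        ?h (i * ?q + k) * ?f (i * ?q + k) + (if i = 0 then 0 else t (i - 1))" for i
      unfolding forward_within_block[OF k] using k by (cases i) (auto simp: t_def algebra_simps)
    have "V (k - 1) = (\<Sum>i\<le>N. ?h (i * ?q + k) * ?f (i * ?q + k)) + (\<Sum>i\<le>N. if i = 0 then 0 else t (i - 1))"
      unfolding V_def h by (rule sum.distrib)
    also have "(\<Sum>i\<le>N. if i = 0 then 0 else t (i - 1)) = (\<Sum>i<N. t i)"
      by (rule sum_atMost_shift)
    also have "(\<Sum>i<N. t i) = (\<Sum>i\<le>N. t i)"
      using \<open>t N = 0\<close> by (simp add: lessThan_Suc_atMost[symmetric])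
    also have "(\<Sum>i\<le>N. ?h (i * ?q + k) * ?f (i * ?q + k)) + (\<Sum>i\<le>N. t i) = V k"
      unfolding V_def backward_within_block[OF k] sum.distrib[symmetric]
      by (intro sum.cong refl) (simp only: t_def distrib_right)
    finally show ?thesis .
  qed
  have V_const: "V k = V 0" if "k \<le> p" for k
    using that
  proof (induction k)
    case (Suc k)
    then show ?case using step[of "Suc k"] by simp
  qed simp
  have V: "V p = V 0"
    by (rule V_const) simp
  (* absorbing U into the left factor leaves a telescoping sum of boundary terms *)
  let ?g = "\<lambda>i. ?h (i * ?q) * ?f (i * ?q)"
  have summand: "y * (?h (i * ?q + p + 1) * ?f (i * ?q + p)) = x * (?h (i * ?q + 0 + 1) * ?f (i * ?q + 0)) + (?g (Suc i) - ?g i)"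
    if "i \<le> N" for i
  proof -
    have "i * ?q < Suc N * ?q"
      using that by (simp only: mult_less_cancel2) simp
    then have "?h (i * ?q) = x * ?h (Suc (i * ?q)) - \<alpha> (Suc (i * ?q)) * ?h (i * ?q + ?q)"
      by (simp only: backward_step dvd_triv_right if_True)
    then have "?h (i * ?q) = x * ?h (i * ?q + 1) - \<alpha> (1 + i * (p + 1)) * ?h (Suc i * ?q)"
      by (simp add: algebra_simps)
    moreover have "?h (i * ?q + p + 1) = ?h (Suc i * ?q)"
      by (simp add: algebra_simps)
    moreover have "y * ?f (i * ?q + p) = \<alpha> (1 + i * (p + 1)) * ?f (i * ?q) + ?f (Suc i * ?q)"
      by (rule forward_end_of_block)
    ultimately show ?thesis
      by (simp only: mult.left_commute[of y] add_0_right) (simp add: algebra_simps)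
  qed
  have "y * V p = (\<Sum>i\<le>N. x * (?h (i * ?q + 0 + 1) * ?f (i * ?q + 0)) + (?g (Suc i) - ?g i))"
    unfolding V_def sum_distrib_left by (intro sum.cong refl summand) simp
  also have "\<dots> = x * V 0 + (\<Sum>i<Suc N. ?g (Suc i) - ?g i)"
    unfolding V_def sum.distrib sum_distrib_left lessThan_Suc_atMost ..
  also have "(\<Sum>i<Suc N. ?g (Suc i) - ?g i) = ?g (Suc N) - ?g 0"
    by (rule sum_lessThan_telescope)
  also have "?g (Suc N) = poly (B (Suc N)) y"
    by (simp add: backward_poly_def type_II_poly_eq_forward del: mult_Suc mult_Suc_right)
  also have "?g 0 = poly (H N 0) x"
    by (simp add: forward_poly_def)
  finally have "y * V 0 = x * V 0 + (poly (B (Suc N)) y - poly (H N 0) x)"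
    unfolding V .
  moreover have "V 0 = (\<Sum>i\<le>N. poly (H N (i * Suc p + 1)) x * poly (B i) y)"
    by (simp add: V_def type_II_poly_eq_forward)
  ultimately show ?thesis
    by (simp add: algebra_simps)
qed

text \<open>The case \<open>x = y\<close> of the Christoffel--Darboux formula.\<close>
lemma backward_0: "H N 0 = B (Suc N)"
  using Christoffel_Darboux[of x x N for x]
  by (simp add: poly_eq_poly_eq_iff[symmetric] fun_eq_iff)

text \<open>On the diagonal the Christoffel--Darboux formula has to be divided by \<open>x - y\<close> first,
as an identity between polynomials in \<open>x\<close>.\<close>
lemma kernel_at_nodes:
  assumes "x \<in> nodes N" "y \<in> nodes N"
  shows "(\<Sum>i\<le>N. poly (H N (i * Suc p + 1)) x * poly (B i) y)
    = (if x = y then poly (pderiv (B (Suc N))) x else 0)"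
proof (cases "x = y")
  case False
  then show ?thesis
    using Christoffel_Darboux[of x y N] assms by (simp add: backward_0)
next
  case True
  define K where "K = (\<Sum>i\<le>N. Polynomial.smult (poly (B i) y) (H N (i * Suc p + 1)))"
  have K: "poly K z = (\<Sum>i\<le>N. poly (H N (i * Suc p + 1)) z * poly (B i) y)" for z
    by (simp add: K_def poly_sum mult.commute)
  have "[:- y, 1:] * K = B (Suc N)"
    using Christoffel_Darboux[of z y N for z] assms(2)
    by (simp add: poly_eq_poly_eq_iff[symmetric] fun_eq_iff K backward_0 algebra_simps)
  then have "pderiv (B (Suc N)) = [:- y, 1:] * pderiv K + K * pderiv [:- y, 1:]"
    by (metis pderiv_mult)
  then show ?thesis
    using True by (simp add: K pderiv_pCons)
qed

lemma backward_eq_sparse: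
  assumes "k \<le> Suc N * Suc p"
  shows "H N k = sparse_poly p (\<lambda>n. \<alpha> (Suc (Suc N * Suc p - Suc n))) (Suc N * Suc p - k)"
  using assms by (simp only: backward_poly_def if_True)

lemma pderiv_at_node_nonzero:
  assumes "x \<in> nodes N"
  shows "poly (pderiv (B (Suc N))) x \<noteq> 0"
  using assms sparse_poly_simple_root[OF p, of "\<lambda>n. \<alpha> (Suc (n - p))" N x] \<alpha>_pos
  unfolding type_II_poly_eq_forward forward_poly_def by simp

text \<open>The residue inequality for the backward sequence; this is where the positivity
of the measures comes from.\<close>
lemma weight_nonneg:
  assumes "x \<in> nodes N" "1 \<le> k" "k \<le> p"
  shows "poly (H N k) x / poly (pderiv (B (Suc N))) x \<ge> 0"
proof -
  have k: "k \<le> Suc N * Suc p" using assms by simp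
  have "poly (H N 0) x = 0" using assms by (simp add: backward_0)
  then have "(poly (H N k) x)\<^sup>2 \<le> poly (pderiv (H N 0)) x * poly (H N k) x"
    using sparse_poly_residue[OF p, of "\<lambda>n. \<alpha> (Suc (Suc N * Suc p - Suc n))" k N x] assms \<alpha>_pos
    unfolding backward_eq_sparse[OF k] backward_eq_sparse[OF le0] by (simp add: less_imp_le del: mult_Suc mult_Suc_right)
  then have "0 \<le> poly (pderiv (B (Suc N))) x * poly (H N k) x"
    unfolding backward_0 by (rule order_trans[OF zero_le_power2])
  then show ?thesis
    by (auto simp: zero_le_mult_iff zero_le_divide_iff)
qed

text \<open>The values at the nodes of left and right eigenvectors form two square matrices \<open>X\<close> and \<open>Y\<close>, and
\<open>X Y = 1\<close> is the orthogonality of eigenvectors at different nodes, normalized on the diagonal. The claim is \<open>Y X = 1\<close>.\<close>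
lemma dual_orthogonality:
  assumes "l \<le> N" "m \<le> N"
  shows "(\<Sum>x\<in>nodes N. poly (B l) x * poly (H N (m * Suc p + 1)) x / poly (pderiv (B (Suc N))) x)
    = (if l = m then 1 else 0)"
proof -
  let ?n = "Suc N"
  let ?F' = "\<lambda>x. poly (pderiv (B (Suc N))) x"
  obtain e where e: "bij_betw e {0..<?n} (nodes N)"
    using ex_bij_betw_nat_finite[OF finite_nodes[of N]] unfolding card_nodes by blast
  have e_in: "e a \<in> nodes N" if "a < ?n" for a
    using bij_betwE[OF e] that by auto
  have e_eq: "e a = e b \<longleftrightarrow> a = b" if "a < ?n" "b < ?n" for a b
    using inj_on_eq_iff[OF bij_betw_imp_inj_on[OF e]] that by auto
  define X where "X = Matrix.mat ?n ?n (\<lambda>(a, i). poly (H N (i * Suc p + 1)) (e a) / ?F' (e a))"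
  define Y where "Y = Matrix.mat ?n ?n (\<lambda>(i, b). poly (B i) (e b))"
  have [simp]: "X \<in> carrier_mat ?n ?n" "Y \<in> carrier_mat ?n ?n"
    by (auto simp: X_def Y_def)
  have "X * Y = 1\<^sub>m ?n"
  proof (rule eq_matI)
    fix a b assume "a < dim_row (1\<^sub>m ?n :: real mat)" "b < dim_col (1\<^sub>m ?n :: real mat)"
    then have ab: "a < ?n" "b < ?n" by auto
    have "(X * Y) $$ (a, b) = (\<Sum>i\<in>{0..<?n}. poly (H N (i * Suc p + 1)) (e a) / ?F' (e a) * poly (B i) (e b))"
      using ab by (simp add: X_def Y_def times_mat_def scalar_prod_def)
    also have "\<dots> = (\<Sum>i\<le>N. poly (H N (i * Suc p + 1)) (e a) * poly (B i) (e b)) / ?F' (e a)"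
      unfolding sum_divide_distrib atLeast0LessThan lessThan_Suc_atMost by simp
    also have "\<dots> = 1\<^sub>m ?n $$ (a, b)"
      unfolding kernel_at_nodes[OF e_in[OF ab(1)] e_in[OF ab(2)]]
      using ab e_eq pderiv_at_node_nonzero[OF e_in[OF ab(1)]] by (cases "a = b") auto
    finally show "(X * Y) $$ (a, b) = 1\<^sub>m ?n $$ (a, b)" .
  qed (auto simp: X_def Y_def)
  then have YX: "Y * X = 1\<^sub>m ?n"
    by (rule mat_mult_left_right_inverse[rotated 2]) auto
  have "(\<Sum>x\<in>nodes N. poly (B l) x * poly (H N (m * Suc p + 1)) x / ?F' x)
    = (\<Sum>a\<in>{0..<?n}. poly (B l) (e a) * poly (H N (m * Suc p + 1)) (e a) / ?F' (e a))"
    by (rule sum.reindex_bij_betw[OF e, symmetric])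
  also have "\<dots> = (Y * X) $$ (l, m)"
    using assms by (simp add: X_def Y_def times_mat_def scalar_prod_def)
  finally show ?thesis
    using assms by (simp add: YX)
qed

section \<open>The initial conditions\<close>

text \<open>The vectors \<open>L\<^sub>i \<cdots> L\<^sub>k\<^sub>-\<^sub>1 e\<^sub>0\<close>, computed with leading principal submatrices of size \<open>p\<close>; for
\<open>i = 1\<close> these are the columns of \<open>\<L>\<close> before normalization.\<close>
definition L_column :: "nat \<Rightarrow> nat \<Rightarrow> real Matrix.vec" where
  "L_column i k = foldr (\<lambda>i v. trunc (p - 1) (lower_factor p \<alpha> i) *\<^sub>v v) [i..<k] (unit_vec p 0)"

lemma dim_L_column [simp]: "dim_vec (L_column i k) = p"
  using p by (cases "i < k") (simp_all add: L_column_def upt_conv_Cons trunc_def)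

lemma L_column_step:
  assumes "i < k" "l < p"
  shows "vec_index (L_column i k) l = vec_index (L_column (Suc i) k) l
    + (if l = 0 then 0 else \<alpha> (i + 1 + (l - 1) * (p + 1)) * vec_index (L_column (Suc i) k) (l - 1))"
proof -
  let ?w = "L_column (Suc i) k"
  have "vec_index (L_column i k) l = vec_index (trunc (p - 1) (lower_factor p \<alpha> i) *\<^sub>v ?w) l"
    using assms by (simp add: L_column_def upt_conv_Cons)
  also have "\<dots> = (\<Sum>j<p. lower_factor p \<alpha> i l j * vec_index ?w j)"
    using assms p by (simp add: trunc_def scalar_prod_def atLeast0LessThan)
  also have "\<dots> = (\<Sum>j\<in>{l, l - 1}. lower_factor p \<alpha> i l j * vec_index ?w j)"
    using assms by (intro sum.mono_neutral_right) (auto simp: lower_factor_def)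
  also have "\<dots> = vec_index ?w l
    + (if l = 0 then 0 else \<alpha> (i + 1 + (l - 1) * (p + 1)) * vec_index ?w (l - 1))"
    by (cases l) (auto simp: lower_factor_def)
  finally show ?thesis .
qed

lemma L_column_0:
  assumes "i \<le> k"
  shows "vec_index (L_column i k) 0 = 1"
  using assms
proof (induction i rule: inc_induct)
  case base
  then show ?case using p by (simp add: L_column_def)
next
  case (step i)
  then show ?case using p L_column_step[of i k 0] by simp
qed

lemma L_column_support:
  assumes "i \<le> k"
  shows "k - i < l \<Longrightarrow> l < p \<Longrightarrow> vec_index (L_column i k) l = 0"
  using assms
proof (induction i arbitrary: l rule: inc_induct)
  case base
  then show ?case by (simp add: L_column_def)
next
  case (step i)
  then show ?case using L_column_step[of i k l] by simp
qed

text \<open>The factors \<open>L\<^sub>i\<close> are moved from the column to the left eigenvector, one at a time; all of them together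
give entry \<open>0\<close> of \<open>v L\<^sub>1 \<cdots> L\<^sub>k\<^sub>-\<^sub>1\<close>, which is \<open>H\<^sub>k\<close>. Cutting the \<open>L\<^sub>i\<close> to size \<open>p\<close> does no harm,
because fewer than \<open>p\<close> factors act on \<open>e\<^sub>0\<close> and the last entry is still zero before each step.\<close>
lemma backward_as_combination:
  assumes "i \<le> k" "1 \<le> i" "k \<le> p"
  shows "(\<Sum>l<p. poly (H N (l * Suc p + i)) x * vec_index (L_column i k) l) = poly (H N k) x"
  using assms
proof (induction i rule: inc_induct)
  case base
  have "(\<Sum>l<p. poly (H N (l * Suc p + k)) x * vec_index (L_column k k) l)
    = (\<Sum>l<p. if l = 0 then poly (H N k) x else 0)"
    by (intro sum.cong) (auto simp: L_column_def)
  then show ?case using p by simp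
next
  case (step i)
  have i: "1 \<le> i" "i \<le> p" using step by auto
  let ?w = "\<lambda>l. vec_index (L_column (Suc i) k) l" and ?h = "\<lambda>m. poly (H N m) x"
  define t where "t l = \<alpha> (i + 1 + l * (p + 1)) * ?h (Suc l * Suc p + i) * ?w l" for l
  obtain r where r: "p = Suc r" using p by (cases p) auto
  have "?w r = 0"
    using step r by (intro L_column_support) auto
  then have "t r = 0" by (simp add: t_def)
  have "(\<Sum>l<p. ?h (l * Suc p + i) * vec_index (L_column i k) l)
    = (\<Sum>l<p. ?h (l * Suc p + i) * ?w l + (if l = 0 then 0 else t (l - 1)))"
  proof (intro sum.cong refl)
    fix l assume "l \<in> {..<p}"
    then have "vec_index (L_column i k) l = ?w l + (if l = 0 then 0 else \<alpha> (i + 1 + (l - 1) * (p + 1)) * ?w (l - 1))"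
      using step by (intro L_column_step) auto
    then show "?h (l * Suc p + i) * vec_index (L_column i k) l = ?h (l * Suc p + i) * ?w l + (if l = 0 then 0 else t (l - 1))"
      by (cases l) (simp_all only: t_def, simp_all add: algebra_simps)
  qed
  also have "\<dots> = (\<Sum>l<p. ?h (l * Suc p + i) * ?w l) + (\<Sum>l<p. if l = 0 then 0 else t (l - 1))"
    by (rule sum.distrib)
  also have "(\<Sum>l<p. if l = 0 then 0 else t (l - 1)) = (\<Sum>l<r. t l)"
    unfolding r lessThan_Suc_atMost by (rule sum_atMost_shift)
  also have "\<dots> = (\<Sum>l<p. t l)"
    using \<open>t r = 0\<close> by (simp add: r)
  also have "(\<Sum>l<p. ?h (l * Suc p + i) * ?w l) + (\<Sum>l<p. t l) = (\<Sum>l<p. ?h (l * Suc p + i + 1) * ?w l)"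
    unfolding backward_within_block[OF i] sum.distrib[symmetric] by (intro sum.cong refl) (simp only: t_def distrib_right)
  also have "\<dots> = ?h k"
    using step.IH step.prems by simp
  finally show ?case .
qed

lemma quadrature_of_backward:
  assumes "1 \<le> k" "k \<le> p" "l \<le> N" "p \<le> N"
  shows "(\<Sum>x\<in>nodes N. poly (H N k) x / poly (pderiv (B (Suc N))) x * poly (B l) x)
    = (if l < p then vec_index (L_column 1 k) l else 0)"
proof -
  let ?c = "\<lambda>m. vec_index (L_column 1 k) m"
  let ?F' = "\<lambda>x. poly (pderiv (B (Suc N))) x"
  have "(\<Sum>x\<in>nodes N. poly (H N k) x / ?F' x * poly (B l) x)
    = (\<Sum>x\<in>nodes N. \<Sum>m<p. ?c m * (poly (B l) x * poly (H N (m * Suc p + 1)) x / ?F' x))"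
    unfolding backward_as_combination[OF assms(1) le_refl assms(2), symmetric] sum_divide_distrib sum_distrib_right
    by (intro sum.cong refl) (simp add: field_simps)
  also have "\<dots> = (\<Sum>m<p. ?c m * (\<Sum>x\<in>nodes N. poly (B l) x * poly (H N (m * Suc p + 1)) x / ?F' x))"
    unfolding sum_distrib_left by (rule sum.swap)
  also have "\<dots> = (\<Sum>m<p. ?c m * (if l = m then 1 else 0))"
    using assms by (intro sum.cong refl arg_cong2[of _ _ _ _ "(*)"] dual_orthogonality) auto
  also have "\<dots> = (if l < p then ?c l else 0)"
    by (simp add: if_distrib cong: if_cong)
  finally show ?thesis .
qed

lemma script_L_index:
  assumes "l < p" "k < p"
  shows "script_L p \<alpha> $$ (l, k) = vec_index (L_column 1 (Suc k)) l / (\<Prod>i<k. \<alpha> (Suc k + i * p))"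
proof -
  have "script_L p \<alpha> $$ (l, k) = vec_index (map (script_L_col p \<alpha>) [1..<Suc p] ! k) l"
    unfolding script_L_def using assms by (intro mat_of_cols_index) auto
  also have "map (script_L_col p \<alpha>) [1..<Suc p] ! k = script_L_col p \<alpha> (Suc k)"
    using assms by (subst nth_map) (auto simp del: upt_Suc)
  also have "script_L_col p \<alpha> (Suc k) = (1 / (\<Prod>i<k. \<alpha> (Suc k + i * p))) \<cdot>\<^sub>v L_column 1 (Suc k)"
    unfolding script_L_col_def L_column_def by simp
  finally show ?thesis using assms by simp
qed

lemma dim_script_L [simp]: "dim_row (script_L p \<alpha>) = p" "dim_col (script_L p \<alpha>) = p"
  by (simp_all add: script_L_def del: upt_Suc)

lemma script_L_denominator_pos: "(\<Prod>i<k. \<alpha> (Suc k + i * p)) > 0"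
  by (simp add: prod_pos \<alpha>_pos)

text \<open>The quadrature weights for \<open>d\<psi>\<close> with index \<open>a + 1\<close>: the \<open>k\<close>-th quadratures, combined with the
coefficients of column \<open>a\<close> of \<open>C\<close>. The denominators are the \<open>d\<close>'s that normalize the columns of \<open>\<L>\<close>.\<close>
definition node_weight :: "real mat \<Rightarrow> nat \<Rightarrow> nat \<Rightarrow> real \<Rightarrow> real" where
  "node_weight C a N x = (\<Sum>k<p. C $$ (k, a) / (\<Prod>i<k. \<alpha> (Suc k + i * p))
     * (poly (H N (Suc k)) x / poly (pderiv (B (Suc N))) x))"

lemma node_weight_nonneg:
  assumes "nonneg_entries p C" "a < p" "x \<in> nodes N"
  shows "node_weight C a N x \<ge> 0"
  unfolding node_weight_def
  using assms script_L_denominator_pos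
  by (intro sum_nonneg mult_nonneg_nonneg divide_nonneg_pos weight_nonneg) (auto simp: nonneg_entries_def)

lemma node_weight_functional:
  assumes C: "C \<in> carrier_mat p p" and a: "a < p" and N: "l \<le> N" "p \<le> N"
  shows "(\<Sum>x\<in>nodes N. node_weight C a N x * poly (B l) x)
    = (if l < p then (script_L p \<alpha> * C) $$ (l, a) else 0)"
proof -
  let ?d = "\<lambda>k. \<Prod>i<k. \<alpha> (Suc k + i * p)"
  have "(\<Sum>x\<in>nodes N. node_weight C a N x * poly (B l) x)
    = (\<Sum>x\<in>nodes N. \<Sum>k<p. C $$ (k, a) / ?d k * (poly (H N (Suc k)) x / poly (pderiv (B (Suc N))) x * poly (B l) x))"
    by (simp add: node_weight_def sum_distrib_right mult.assoc)
  also have "\<dots> = (\<Sum>k<p. C $$ (k, a) / ?d k *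
      (\<Sum>x\<in>nodes N. poly (H N (Suc k)) x / poly (pderiv (B (Suc N))) x * poly (B l) x))"
    unfolding sum_distrib_left by (rule sum.swap)
  also have "\<dots> = (\<Sum>k<p. C $$ (k, a) / ?d k * (if l < p then vec_index (L_column 1 (Suc k)) l else 0))"
    using N by (intro sum.cong refl arg_cong2[of _ _ _ _ "(*)"] quadrature_of_backward) auto
  also have "\<dots> = (if l < p then \<Sum>k<p. script_L p \<alpha> $$ (l, k) * C $$ (k, a) else 0)"
    by (auto simp: script_L_index intro!: sum.cong)
  also have "\<dots> = (if l < p then (script_L p \<alpha> * C) $$ (l, a) else 0)"
    using C a by (auto simp: scalar_prod_def atLeast0LessThan)
  finally show ?thesis .
qed

text \<open>The diagonal entry of \<open>C\<close> alone contributes a positive amount. Positive mass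
allows the quadratures to be normalized to probability measures.\<close>
lemma total_mass_pos:
  assumes C: "upper_unitriangular p C" "nonneg_entries p C" and a: "a < p"
  shows "(script_L p \<alpha> * C) $$ (0, a) > 0"
proof -
  let ?d = "\<lambda>k. \<Prod>i<k. \<alpha> (Suc k + i * p)"
  have "(script_L p \<alpha> * C) $$ (0, a) = (\<Sum>k<p. script_L p \<alpha> $$ (0, k) * C $$ (k, a))"
    using C(1) a p by (auto simp: scalar_prod_def atLeast0LessThan upper_unitriangular_def)
  also have "\<dots> = (\<Sum>k<p. C $$ (k, a) / ?d k)"
    using p by (intro sum.cong) (auto simp: script_L_index L_column_0)
  also have "\<dots> > 0"
    using C a script_L_denominator_pos
    by (intro sum_pos2[of _ a]) (auto simp: upper_unitriangular_def nonneg_entries_def intro!: divide_nonneg_pos)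
  finally show ?thesis .
qed

text \<open>The functionals \<open>I a\<close> stand for integration against \<open>d\<psi>\<^sub>a\<close>. Computing \<open>\<Sum>\<^sub>a I\<^sub>a (x A\<^sub>n B\<^sub>l)\<close> with the recurrence
for \<open>A\<close> and with that for \<open>B\<close> gives linear relations between the numbers
\<open>J k l = \<Sum>\<^sub>a I\<^sub>a (A\<^sub>k B\<^sub>l)\<close>. Because \<open>T\<^sub>n\<^sub>+\<^sub>p\<^sub>,\<^sub>n \<noteq> 0\<close>, all of them are determined by those with
\<open>k < p\<close>, and the Kronecker delta satisfies the same relations.\<close>
lemma biorthogonality:
  fixes I :: "nat \<Rightarrow> real poly \<Rightarrow> real"
  assumes add: "\<And>a q r. a \<in> {1..p} \<Longrightarrow> I a (q + r) = I a q + I a r"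
    and smult: "\<And>a c q. a \<in> {1..p} \<Longrightarrow> I a (Polynomial.smult c q) = c * I a q"
    and typeI: "type_I_polys p T \<nu> A"
    and init: "\<And>k l. k < p \<Longrightarrow> (\<Sum>a\<in>{1..p}. \<nu> $$ (k, a - 1) * I a (B l)) = (if k = l then 1 else 0)"
  shows "(\<Sum>a\<in>{1..p}. I a (A a k * B l)) = (if k = l then 1 else 0)"
proof -
  define J where "J k l = (\<Sum>a\<in>{1..p}. I a (A a k * B l))" for k l
  have zero: "I a 0 = 0" if "a \<in> {1..p}" for a
    using smult[OF that, of 0 0] by simp
  have sum: "I a (\<Sum>j\<in>S. f j) = (\<Sum>j\<in>S. I a (f j))" if "a \<in> {1..p}" "finite S" for a f and S :: "nat set"
    using that(2) by (induction S) (simp_all add: zero[OF that(1)] add[OF that(1)])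
  have xB: "[:0, 1:] * B l = (\<Sum>j\<le>Suc l. Polynomial.smult (T l j) (B j))" for l
    using type_II_recurrence[of l] by (simp add: poly_eq_poly_eq_iff[symmetric] fun_eq_iff poly_sum)
  have rec: "(if n = 0 then 0 else J (n - 1) l) + (\<Sum>i\<le>p. T (n + i) n * J (n + i) l) = (\<Sum>j\<le>Suc l. T l j * J n j)" for n l
  proof -
    have "(if n = 0 then 0 else I a (A a (n - 1) * B l)) + (\<Sum>i\<le>p. T (n + i) n * I a (A a (n + i) * B l))
      = (\<Sum>j\<le>Suc l. T l j * I a (A a n * B j))" if a: "a \<in> {1..p}" for a
    proof -
      have "((if n = 0 then 0 else A a (n - 1)) + (\<Sum>i\<le>p. Polynomial.smult (T (n + i) n) (A a (n + i)))) * B l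
        = [:0, 1:] * A a n * B l"
        using typeI a by (simp only: type_I_polys_def)
      also have "\<dots> = A a n * (\<Sum>j\<le>Suc l. Polynomial.smult (T l j) (B j))"
        unfolding xB[symmetric] by (simp only: mult.assoc mult.left_commute)
      finally have "I a ((if n = 0 then 0 else A a (n - 1)) * B l + (\<Sum>i\<le>p. Polynomial.smult (T (n + i) n) (A a (n + i) * B l)))
        = I a (\<Sum>j\<le>Suc l. Polynomial.smult (T l j) (A a n * B j))"
        by (simp only: distrib_right sum_distrib_right sum_distrib_left mult_smult_left mult_smult_right)
      then show ?thesis
        unfolding add[OF a] sum[OF a finite_atMost] smult[OF a] by (auto simp: zero[OF a])
    qed
    then have "(\<Sum>a\<in>{1..p}. (if n = 0 then 0 else I a (A a (n - 1) * B l)) + (\<Sum>i\<le>p. T (n + i) n * I a (A a (n + i) * B l)))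
      = (\<Sum>a\<in>{1..p}. \<Sum>j\<le>Suc l. T l j * I a (A a n * B j))"
      by (rule sum.cong[OF refl])
    moreover have "(\<Sum>a\<in>{1..p}. \<Sum>i\<le>p. T (n + i) n * I a (A a (n + i) * B l)) = (\<Sum>i\<le>p. T (n + i) n * J (n + i) l)"
      unfolding J_def sum_distrib_left by (rule sum.swap)
    moreover have "(\<Sum>a\<in>{1..p}. \<Sum>j\<le>Suc l. T l j * I a (A a n * B j)) = (\<Sum>j\<le>Suc l. T l j * J n j)"
      unfolding J_def sum_distrib_left by (rule sum.swap)
    moreover have "(\<Sum>a\<in>{1..p}. if n = 0 then 0 else I a (A a (n - 1) * B l)) = (if n = 0 then 0 else J (n - 1) l)"
      by (simp add: J_def)
    ultimately show ?thesis
      by (simp only: sum.distrib)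
  qed
  have "J k l = (if k = l then 1 else 0)" for l
  proof (induction k arbitrary: l rule: less_induct)
    case (less k)
    show ?case
    proof (cases "k < p")
      case True
      have "J k l = (\<Sum>a\<in>{1..p}. \<nu> $$ (k, a - 1) * I a (B l))"
        unfolding J_def
      proof (intro sum.cong refl)
        fix a assume a: "a \<in> {1..p}"
        then have "A a k = [:\<nu> $$ (k, a - 1):]"
          using typeI True by (simp add: type_I_polys_def)
        then show "I a (A a k * B l) = \<nu> $$ (k, a - 1) * I a (B l)"
          using smult[OF a] by simp
      qed
      then show ?thesis using init[OF True] by simp
    next
      case False
      (* all terms of the recurrence at n other than T k n * J k l are known *)
      define n where "n = k - p"
      have k: "k = n + p" using False by (simp add: n_def)
      have IH: "J m l = (if m = l then 1 else 0)" if "m < n + p" for m l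
        using less.IH that k by simp
      have "(\<Sum>j\<le>Suc l. T l j * J n j) = (\<Sum>j\<le>Suc l. if j = n then T l n else 0)"
        using IH[of n] p by (intro sum.cong) auto
      also have "\<dots> = T l n"
        using T_above[of l n] by auto
      finally have 1: "(\<Sum>j\<le>Suc l. T l j * J n j) = T l n" .
      have 2: "(if n = 0 then 0 else J (n - 1) l) = (if Suc l = n then 1 else 0)"
        using IH[of "n - 1" l] by auto
      have "(\<Sum>i<p. T (n + i) n * J (n + i) l) = (\<Sum>i<p. if n \<le> l \<and> i = l - n then T l n else 0)"
        using IH by (intro sum.cong) auto
      also have "\<dots> = (if n \<le> l \<and> l < n + p then T l n else 0)"
        by (cases "n \<le> l") auto
      finally have 3: "(\<Sum>i<p. T (n + i) n * J (n + i) l) = (if n \<le> l \<and> l < n + p then T l n else 0)" .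
      have "(\<Sum>i\<le>p. T (n + i) n * J (n + i) l) = (\<Sum>i<p. T (n + i) n * J (n + i) l) + T k n * J k l"
        unfolding lessThan_Suc_atMost[symmetric] k by simp
      then have "T k n * J k l = T l n - (if Suc l = n then 1 else 0) - (if n \<le> l \<and> l < n + p then T l n else 0)"
        using rec[of n l] 1 2 3 by simp
      also have "\<dots> = T k n * (if k = l then 1 else 0)"
      proof -
        consider "Suc l < n" | "Suc l = n" | "n \<le> l" "l < n + p" | "l = k" | "l > n + p"
          using k by linarith
        then show ?thesis
          by cases (use T_above[of l n] T_superdiagonal[of l] T_below[of n l] k p in auto)
      qed
      finally show ?thesis
        using T_corner[of n] k by simp
    qed
  qed
  then show ?thesis by (simp add: J_def)
qed

end

section \<open>Weak limits of quadratures\<close>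

definition discrete_measure :: "real set \<Rightarrow> (real \<Rightarrow> real) \<Rightarrow> real measure" where
  "discrete_measure S w = distr (point_measure S (\<lambda>x. ennreal (w x))) borel (\<lambda>x. x)"

lemma integral_discrete_measure:
  fixes f :: "real \<Rightarrow> real"
  assumes "finite S" "\<And>x. x \<in> S \<Longrightarrow> w x \<ge> 0" "f \<in> borel_measurable borel"
  shows "integral\<^sup>L (discrete_measure S w) f = (\<Sum>x\<in>S. w x * f x)"
proof -
  have "integral\<^sup>L (discrete_measure S w) f = integral\<^sup>L (point_measure S (\<lambda>x. ennreal (w x))) f"
    unfolding discrete_measure_def using assms(3) by (intro integral_distr) auto
  also have "\<dots> = (\<Sum>x\<in>S. w x * f x)"
    using assms by (simp add: lebesgue_integral_point_measure_finite)
  finally show ?thesis .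
qed

lemma real_distribution_discrete_measure:
  assumes "finite S" "\<And>x. x \<in> S \<Longrightarrow> w x \<ge> 0" "(\<Sum>x\<in>S. w x) = 1"
  shows "real_distribution (discrete_measure S w)"
proof -
  have "prob_space (point_measure S (\<lambda>x. ennreal (w x)))"
    using assms by (intro prob_spaceI) (simp add: space_point_measure emeasure_point_measure_finite sum_ennreal)
  then show ?thesis
    unfolding discrete_measure_def by (rule prob_space.real_distribution_distr) simp
qed

text \<open>Stieltjes functions for measures of arbitrary mass are obtained from
the distribution functions of probability measures.\<close>
lemma interval_measure_scaled_cdf:
  assumes \<nu>: "real_distribution \<nu>" and M: "M > 0"
  shows "stieltjes_function (\<lambda>x. M * cdf \<nu> x)"
    and "interval_measure (\<lambda>x. M * cdf \<nu> x) = density \<nu> (\<lambda>_. ennreal M)"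
proof -
  interpret real_distribution \<nu> by fact
  let ?\<psi> = "\<lambda>x. M * cdf \<nu> x"
  have mono: "?\<psi> x \<le> ?\<psi> y" if "x \<le> y" for x y
    using M cdf_nondecreasing[OF that] by simp
  have rc: "continuous (at_right x) ?\<psi>" for x
    by (intro continuous_intros cdf_is_right_cont)
  show "stieltjes_function ?\<psi>"
    using mono rc by (simp add: stieltjes_function_def mono_def)
  have bot: "(?\<psi> \<longlongrightarrow> 0) at_bot"
    using tendsto_mult[OF tendsto_const[of M] cdf_lim_at_bot] by simp
  have top: "(?\<psi> \<longlongrightarrow> M) at_top"
    using tendsto_mult[OF tendsto_const[of M] cdf_lim_at_top_prob] by simp
  show "interval_measure ?\<psi> = density \<nu> (\<lambda>_. ennreal M)"
  proof (rule cdf_unique')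
    show "finite_borel_measure (interval_measure ?\<psi>)"
      using M by (intro finite_borel_measure_interval_measure[OF mono rc bot top]) auto
    show "finite_borel_measure (density \<nu> (\<lambda>_. ennreal M))"
    proof (intro finite_borel_measure.intro finite_measureI finite_borel_measure_axioms.intro)
      show "emeasure (density \<nu> (\<lambda>_. ennreal M)) (space (density \<nu> (\<lambda>_. ennreal M))) \<noteq> \<infinity>"
        using emeasure_space_1 by (simp add: emeasure_density_const)
    qed simp
    have "cdf (density \<nu> (\<lambda>_. ennreal M)) x = ?\<psi> x" for x
      using M by (simp add: cdf_def measure_def emeasure_density_const enn2real_mult)
    then show "cdf (interval_measure ?\<psi>) = cdf (density \<nu> (\<lambda>_. ennreal M))"
      using cdf_interval_measure[OF mono rc bot] by (simp add: fun_eq_iff)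
  qed
qed

lemma clamp_bounded:
  fixes f :: "real \<Rightarrow> real"
  assumes "a \<le> b" "continuous_on UNIV f"
  obtains K where "\<And>x. \<bar>f (max a (min b x))\<bar> \<le> K"
proof -
  have "compact (f ` {a..b})"
    using assms by (intro compact_continuous_image continuous_on_subset[OF assms(2)]) auto
  then obtain K where K: "\<And>y. y \<in> f ` {a..b} \<Longrightarrow> norm y \<le> K"
    using compact_imp_bounded bounded_iff by metis
  have "\<bar>f (max a (min b x))\<bar> \<le> K" for x
    using K[of "f (max a (min b x))"] assms(1) by auto
  then show ?thesis by (rule that)
qed

text \<open>After normalization this is Helly's selection theorem. Weak convergence tests only bounded functions, so
polynomials are replaced by their compositions with the projection onto \<open>[a, b]\<close>; that the limit does not
charge the complement follows from testing with a bounded function that vanishes exactly on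
\<open>[a, b]\<close>.\<close>
lemma weak_limit_of_quadratures:
  fixes S :: "nat \<Rightarrow> real set" and w :: "nat \<Rightarrow> real \<Rightarrow> real" and q :: "nat \<Rightarrow> real poly"
  assumes fin: "\<And>N. finite (S N)" and sub: "\<And>N. S N \<subseteq> {a..b}"
    and nonneg: "\<And>N x. x \<in> S N \<Longrightarrow> w N x \<ge> 0"
    and mass: "\<And>N. (\<Sum>x\<in>S N. w N x) = M" and M: "M > 0"
    and quad: "\<And>l. \<forall>\<^sub>F N in sequentially. (\<Sum>x\<in>S N. w N x * poly (q l) x) = c l"
  obtains \<psi> where "stieltjes_function \<psi>"
    "compact (measure_support (interval_measure \<psi>))"
    "measure_support (interval_measure \<psi>) \<subseteq> {a..b}"
    "\<And>r. set_integrable (interval_measure \<psi>) {a..b} (poly r)"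
    "\<And>l. (LINT x:{a..b}|interval_measure \<psi>. poly (q l) x) = c l"
proof -
  define \<mu> where "\<mu> N = discrete_measure (S N) (\<lambda>x. w N x / M)" for N
  have int_\<mu>: "integral\<^sup>L (\<mu> N) f = (\<Sum>x\<in>S N. w N x * f x) / M"
    if "f \<in> borel_measurable borel" for f N
    unfolding \<mu>_def using fin nonneg M that
    by (subst integral_discrete_measure) (auto simp: sum_divide_distrib)
  have \<mu>: "real_distribution (\<mu> N)" for N
    unfolding \<mu>_def using fin nonneg M mass[of N]
    by (intro real_distribution_discrete_measure) (auto simp flip: sum_divide_distrib)
  have "S 0 \<noteq> {}" using mass[of 0] M by auto
  then have ab: "a \<le> b" using sub[of 0] by fastforce
  have "measure (\<mu> N) {a - 1<..b} = 1" for N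
  proof -
    interpret real_distribution "\<mu> N" by (rule \<mu>)
    have "measure (\<mu> N) {a - 1<..b} = integral\<^sup>L (\<mu> N) (indicator {a - 1<..b})"
      by simp
    also have "\<dots> = (\<Sum>x\<in>S N. w N x * indicator {a - 1<..b} x) / M"
      by (rule int_\<mu>) simp
    also have "(\<Sum>x\<in>S N. w N x * indicator {a - 1<..b} x) = (\<Sum>x\<in>S N. w N x)"
      using sub[of N] by (intro sum.cong refl) (force simp: indicator_def)
    finally show ?thesis
      using mass M by simp
  qed
  then have "\<exists>c d. c < d \<and> (\<forall>N. measure (\<mu> N) {c<..d} > 1 - \<epsilon>)" if "\<epsilon> > 0" for \<epsilon>
    using that ab by (intro exI[of _ "a - 1"] exI[of _ b]) simp
  then have "tight \<mu>"
    unfolding tight_def using \<mu> by blast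
  then obtain r \<nu> where r: "strict_mono r" and \<nu>: "real_distribution \<nu>" and conv: "weak_conv_m (\<mu> \<circ> id \<circ> r) \<nu>"
    using tight_imp_convergent_subsubsequence[of \<mu> id] strict_mono_id by blast
  interpret \<nu>: real_distribution \<nu> by fact
  have lim: "(\<lambda>n. integral\<^sup>L (\<mu> (r n)) f) \<longlonglongrightarrow> integral\<^sup>L \<nu> f"
    if "\<And>x. isCont f x" "\<And>x. norm (f x) \<le> K" for f :: "real \<Rightarrow> real" and K
    using weak_conv_imp_integral_bdd_continuous_conv[OF _ \<nu> conv, of f K] \<mu> that by simp
  have bounded_integrable: "integrable \<nu> f" if "f \<in> borel_measurable borel" "\<And>x. \<bar>f x\<bar> \<le> K" for f :: "real \<Rightarrow> real" and K
    using that by (intro \<nu>.integrable_const_bound[of _ K]) auto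
  have borel: "f \<in> borel_measurable borel" if "\<And>x. isCont f x" for f :: "real \<Rightarrow> real"
    using that by (intro borel_measurable_continuous_onI continuous_at_imp_continuous_on) auto
  have supp: "AE x in \<nu>. x \<in> {a..b}"
  proof -
    define d where "d x = min 1 (max 0 (max (a - x) (x - b)))" for x :: real
    have cont: "isCont d x" for x
      unfolding d_def by (intro continuous_intros)
    have d01: "0 \<le> d x" "\<bar>d x\<bar> \<le> 1" for x
      by (auto simp: d_def)
    have "integral\<^sup>L (\<mu> (r n)) d = 0" for n
      using sub[of "r n"] by (subst int_\<mu>[OF borel[OF cont]]) (force simp: d_def intro!: sum.neutral)
    then have "integral\<^sup>L \<nu> d = 0"
      using lim[OF cont, of 1] d01 by (simp add: LIMSEQ_const_iff)
    moreover have "integrable \<nu> d"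
      using borel[OF cont] d01(2) by (rule bounded_integrable)
    ultimately have "AE x in \<nu>. d x = 0"
      using d01 by (simp add: integral_nonneg_eq_0_iff_AE)
    then show ?thesis
      by (rule AE_mp) (auto simp: d_def min_def max_def split: if_splits)
  qed
  define h where "h r x = poly r (max a (min b x))" for r :: "real poly" and x
  have h_cont: "isCont (h r) x" for r x
    unfolding h_def by (intro continuous_intros)
  have "\<exists>K. \<forall>x. \<bar>h r x\<bar> \<le> K" for r
  proof -
    have "continuous_on UNIV (poly r)"
      by (intro continuous_intros)
    from clamp_bounded[OF ab this] show ?thesis
      unfolding h_def by blast
  qed
  then obtain K where K: "\<And>r x. \<bar>h r x\<bar> \<le> K r"
    by metis
  have h_measurable: "h r \<in> borel_measurable \<nu>" for r
    by (simp add: borel[OF h_cont])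
  let ?\<psi> = "\<lambda>x. M * cdf \<nu> x"
  note \<psi> = interval_measure_scaled_cdf[OF \<nu> M]
  have ind: "(\<lambda>x. indicator {a..b} x *\<^sub>R poly r x) \<in> borel_measurable borel" for r
    using borel[of "poly r"] by (intro borel_measurable_scaleR borel_measurable_indicator) auto
  have ind_eq: "AE x in \<nu>. indicator {a..b} x *\<^sub>R poly r x = h r x" for r
    using supp by (rule AE_mp) (auto simp: h_def)
  have int_ind: "integrable \<nu> (\<lambda>x. indicator {a..b} x *\<^sub>R poly r x)" for r
    using bounded_integrable[OF borel[OF h_cont] K] ind ind_eq
    by (subst integrable_cong_AE[where g = "h r"]) (auto intro: h_measurable)
  have set_int: "set_integrable (interval_measure ?\<psi>) {a..b} (poly r)" for r
    unfolding set_integrable_def \<psi>(2) using int_ind[of r] ind[of r] M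
    by (subst integrable_density) auto
  have set_val: "(LINT x:{a..b}|interval_measure ?\<psi>. poly r x) = M * integral\<^sup>L \<nu> (h r)" for r
  proof -
    have "(LINT x:{a..b}|interval_measure ?\<psi>. poly r x) = (LINT x|\<nu>. M *\<^sub>R (indicator {a..b} x *\<^sub>R poly r x))"
      unfolding set_lebesgue_integral_def \<psi>(2) using ind[of r] M by (subst integral_density) auto
    also have "\<dots> = M * (LINT x|\<nu>. indicator {a..b} x *\<^sub>R poly r x)"
      by (simp only: real_scaleR_def[of M] integral_mult_right_zero)
    also have "(LINT x|\<nu>. indicator {a..b} x *\<^sub>R poly r x) = integral\<^sup>L \<nu> (h r)"
      using ind_eq[of r] ind[of r] by (intro integral_cong_AE) (auto intro: h_measurable)
    finally show ?thesis .
  qed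
  have val: "(LINT x:{a..b}|interval_measure ?\<psi>. poly (q l) x) = c l" for l
  proof -
    have "\<forall>\<^sub>F n in sequentially. (\<Sum>x\<in>S (r n). w (r n) x * poly (q l) x) = c l"
      using filterlim_subseq[OF r] quad[of l] by (rule eventually_compose_filterlim[rotated])
    then have "\<forall>\<^sub>F n in sequentially. integral\<^sup>L (\<mu> (r n)) (h (q l)) = c l / M"
    proof (rule eventually_mono)
      fix n assume *: "(\<Sum>x\<in>S (r n). w (r n) x * poly (q l) x) = c l"
      have "(\<Sum>x\<in>S (r n). w (r n) x * h (q l) x) = (\<Sum>x\<in>S (r n). w (r n) x * poly (q l) x)"
        using sub[of "r n"] by (intro sum.cong refl) (force simp: h_def)
      then show "integral\<^sup>L (\<mu> (r n)) (h (q l)) = c l / M"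
        using * int_\<mu>[OF borel[OF h_cont]] by simp
    qed
    then have "(\<lambda>n. integral\<^sup>L (\<mu> (r n)) (h (q l))) \<longlonglongrightarrow> c l / M"
      by (rule tendsto_eventually)
    then have "integral\<^sup>L \<nu> (h (q l)) = c l / M"
      using lim[OF h_cont, of "q l" "K (q l)"] K by (auto intro: LIMSEQ_unique)
    then show ?thesis
      using set_val M by simp
  qed
  have sup: "measure_support (interval_measure ?\<psi>) \<subseteq> {a..b}"
  proof
    fix x assume x: "x \<in> measure_support (interval_measure ?\<psi>)"
    show "x \<in> {a..b}"
    proof (rule ccontr)
      assume "x \<notin> {a..b}"
      then have "emeasure (interval_measure ?\<psi>) (- {a..b}) > 0"
        using x unfolding measure_support_def by (simp add: open_Compl)
      moreover have "emeasure \<nu> (- {a..b}) = 0"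
      proof (rule AE_iff_measurable[THEN iffD1, rotated 2])
        show "AE x in \<nu>. x \<in> {a..b}" by (rule supp)
        show "- {a..b} \<in> sets \<nu>" by simp
        show "{x \<in> space \<nu>. x \<notin> {a..b}} = - {a..b}" by auto
      qed
      then have "emeasure (interval_measure ?\<psi>) (- {a..b}) = 0"
        unfolding \<psi>(2) by (subst emeasure_density_const) auto
      ultimately show False by simp
    qed
  qed
  have "closed (measure_support (interval_measure ?\<psi>))"
    unfolding closed_def
  proof (subst open_subopen, rule ballI)
    fix x assume "x \<in> - measure_support (interval_measure ?\<psi>)"
    then obtain U where U: "open U" "x \<in> U" "\<not> emeasure (interval_measure ?\<psi>) U > 0"
      unfolding measure_support_def by blast
    then have "U \<subseteq> - measure_support (interval_measure ?\<psi>)"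
      unfolding measure_support_def by blast
    then show "\<exists>U. open U \<and> x \<in> U \<and> U \<subseteq> - measure_support (interval_measure ?\<psi>)"
      using U by blast
  qed
  then have "compact (measure_support (interval_measure ?\<psi>))"
    using sup by (metis bounded_closed_interval bounded_subset compact_eq_bounded_closed)
  then show ?thesis
    using that[OF \<psi>(1) _ sup set_int val] by blast
qed

section \<open>Existence of the measures\<close>

lemma lower_unitriangular_inverse:
  assumes "lower_unitriangular p \<nu>"
  obtains X where "X \<in> carrier_mat p p" "\<nu> * X = 1\<^sub>m p" "inverse_transpose \<nu> = transpose_mat X"
proof -
  have \<nu>: "\<nu> \<in> carrier_mat p p" "\<And>i. i < p \<Longrightarrow> \<nu> $$ (i, i) = 1"
      "\<And>i j. i < j \<Longrightarrow> j < p \<Longrightarrow> \<nu> $$ (i, j) = 0"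
    using assms by (auto simp: lower_unitriangular_def)
  have "det \<nu> = prod_list (diag_mat \<nu>)"
    using \<nu>(3) by (intro det_lower_triangular[OF _ \<nu>(1)]) auto
  also have "\<dots> = 1"
    using \<nu>(1,2) by (intro prod_list_neutral) (auto simp: diag_mat_def)
  finally have "\<nu> \<in> Units (ring_mat TYPE(real) p ())"
    using \<nu>(1) by (intro det_non_zero_imp_unit) auto
  then obtain X where "mat_inverse \<nu> = Some X"
    using mat_inverse(1)[OF \<nu>(1)] by fastforce
  then show ?thesis
    using that[of X] mat_inverse(2)[OF \<nu>(1)] by (simp add: inverse_transpose_def)
qed

theorem theorem6:
  fixes p :: nat and T :: smat and \<alpha> :: "nat \<Rightarrow> real" and \<nu> C :: "real mat"
    and A :: "nat \<Rightarrow> nat \<Rightarrow> real poly"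
  assumes "p \<ge> 1"
    and "monic_banded_Hessenberg p T"
    and "smat_norm_inf T < \<infinity>"
    and "positive_bidiagonal_factorization p T \<alpha>"
    and "lower_unitriangular p \<nu>"
    and "type_I_polys p T \<nu> A"
    and "upper_unitriangular p C"
    and "nonneg_entries p C"
    and "inverse_transpose \<nu> = script_L p \<alpha> * C"
  shows "\<exists>\<psi> :: nat \<Rightarrow> real \<Rightarrow> real.
    (\<forall>a\<in>{1..p}. stieltjes_function (\<psi> a)
        \<and> compact (measure_support (interval_measure (\<psi> a)))
        \<and> measure_support (interval_measure (\<psi> a)) \<subseteq> Delta T) \<and>
    (\<forall>k l. (\<Sum>a\<in>{1..p}. LINT x:Delta T|interval_measure (\<psi> a).
              poly (A a k) x * poly (type_II_poly p T l) x) = (if k = l then 1 else 0))"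
proof -
  interpret bidiagonal_hessenberg p T \<alpha>
    using assms by unfold_locales
  obtain X where X: "X \<in> carrier_mat p p" "\<nu> * X = 1\<^sub>m p" "transpose_mat X = script_L p \<alpha> * C"
    using lower_unitriangular_inverse[OF assms(5)] assms(9) by metis
  have C: "C \<in> carrier_mat p p"
    using assms(7) by (simp add: upper_unitriangular_def)
  have X_index: "X $$ (a, l) = (script_L p \<alpha> * C) $$ (l, a)" if "a < p" "l < p" for a l
    using that X(1) unfolding X(3)[symmetric] by simp
  define mom where "mom a l = (if l < p then (script_L p \<alpha> * C) $$ (l, a) else 0)" for a l
  define \<xi> where "\<xi> = lim (smallest_eigenvalue T)"
  define \<eta> where "\<eta> = lim (largest_eigenvalue T)"
  have \<Delta>: "Delta T = {\<xi>..\<eta>}" by (simp add: Delta_def \<xi>_def \<eta>_def)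
  define P where "P a \<psi> \<longleftrightarrow> stieltjes_function \<psi> \<and> compact (measure_support (interval_measure \<psi>))
    \<and> measure_support (interval_measure \<psi>) \<subseteq> Delta T
    \<and> (\<forall>r. set_integrable (interval_measure \<psi>) (Delta T) (poly r))
    \<and> (\<forall>l. (LINT x:Delta T|interval_measure \<psi>. poly (B l) x) = mom (a - 1) l)" for a \<psi>
  have "\<exists>\<psi>. P a \<psi>" if a: "a \<in> {1..p}" for a
  proof -
    have a': "a - 1 < p" using a by auto
    (* the shift by p skips the small truncations, where the quadrature identities can fail *)
    let ?w = "\<lambda>N. node_weight C (a - 1) (N + p)"
    have functional: "(\<Sum>x\<in>nodes (N + p). ?w N x * poly (B l) x) = mom (a - 1) l" if "l \<le> N + p" for N l
      unfolding mom_def by (rule node_weight_functional[OF C a' that]) simp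
    show ?thesis
    proof (rule weak_limit_of_quadratures[where S = "\<lambda>N. nodes (N + p)" and w = ?w and q = B
          and c = "mom (a - 1)" and M = "mom (a - 1) 0" and a = \<xi> and b = \<eta>])
      show "nodes (N + p) \<subseteq> {\<xi>..\<eta>}" for N
        using nodes_subset_Delta[OF assms(3)] by (simp only: \<Delta>)
      show "0 \<le> ?w N x" if "x \<in> nodes (N + p)" for N x
        using assms(8) a' that by (rule node_weight_nonneg)
      show "(\<Sum>x\<in>nodes (N + p). ?w N x) = mom (a - 1) 0" for N
        using functional[of 0 N] by simp
      show "mom (a - 1) 0 > 0"
        using total_mass_pos[OF assms(7,8) a'] p by (simp add: mom_def)
      show "\<forall>\<^sub>F N in sequentially. (\<Sum>x\<in>nodes (N + p). ?w N x * poly (B l) x) = mom (a - 1) l" for l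
        using functional by (intro eventually_sequentiallyI[of l]) simp
    qed (use finite_nodes in \<open>auto simp: P_def \<Delta>\<close>)
  qed
  then obtain \<psi> where \<psi>: "\<And>a. a \<in> {1..p} \<Longrightarrow> P a (\<psi> a)"
    by metis
  define I where "I a r = (LINT x:Delta T|interval_measure (\<psi> a). poly r x)" for a r
  have set_int: "set_integrable (interval_measure (\<psi> a)) (Delta T) (poly r)" if "a \<in> {1..p}" for a r
    using \<psi>[OF that] by (simp add: P_def)
  have "(\<Sum>a\<in>{1..p}. I a (A a k * B l)) = (if k = l then 1 else 0)" for k l
  proof (rule biorthogonality[OF _ _ assms(6)])
    fix a q r assume a: "a \<in> {1..p}"
    show "I a (q + r) = I a q + I a r"
      using set_integral_add(2)[OF set_int[OF a, of q] set_int[OF a, of r]] by (simp add: I_def)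
  next
    fix a c q
    show "I a (Polynomial.smult c q) = c * I a q"
      by (simp add: I_def)
  next
    fix k l assume k: "k < p"
    have I_B: "I a (B l) = mom (a - 1) l" if "a \<in> {1..p}" for a
      using \<psi>[OF that] by (simp add: P_def I_def)
    show "(\<Sum>a\<in>{1..p}. \<nu> $$ (k, a - 1) * I a (B l)) = (if k = l then 1 else 0)"
    proof (cases "l < p")
      case True
      have "(\<Sum>a\<in>{1..p}. \<nu> $$ (k, a - 1) * I a (B l)) = (\<Sum>a\<in>{1..p}. \<nu> $$ (k, a - 1) * X $$ (a - 1, l))"
        using True by (intro sum.cong refl) (auto simp: I_B mom_def X_index)
      also have "\<dots> = (\<Sum>a<p. \<nu> $$ (k, a) * X $$ (a, l))"
        by (rule sum.reindex_bij_witness[where i = Suc and j = "\<lambda>a. a - 1"]) auto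
      also have "\<dots> = (\<nu> * X) $$ (k, l)"
        using X(1) assms(5) k True by (auto simp: lower_unitriangular_def scalar_prod_def atLeast0LessThan)
      finally show ?thesis
        using k True by (simp add: X(2))
    next
      case False
      then show ?thesis using k by (simp add: I_B mom_def)
    qed
  qed
  then have "(\<Sum>a\<in>{1..p}. LINT x:Delta T|interval_measure (\<psi> a). poly (A a k) x * poly (B l) x)
    = (if k = l then 1 else 0)" for k l
    by (simp add: I_def)
  then show ?thesis
    using \<psi> by (intro exI[of _ \<psi>]) (auto simp: P_def)
qed

end
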